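(* Let $G$ be a connected, well-edge-dominated graph containing exactly one triangle $xyz$. If for every edge $f\in\{xy,xz,yz\}$ the graph $G-N_e[f]$ contains at least two nontrivial components, and each of $x,y,z$ has degree at least $3$ in $G$, then $G\in\mathcal{F}$.
   Context: All graphs are simple and finite. A set $F$ of edges of $G$ is an edge dominating set if every edge of $G$ is in $F$ or shares an endpoint with an edge of $F$. $G$ is well-edge-dominated if all minimal (with respect to inclusion) edge dominating sets of $G$ have the same cardinality. A triangle is a subgraph isomorphic to $K_3$. For an edge $f$, $G-N_e[f]$ denotes the graph obtained from $G$ by deleting both endpoints of $f$ (and all incident edges). A graph is nontrivial if it has at least two vertices. A support vertex is a vertex adjacent to a vertex of degree $1$. Let $G'$ be a well-edge-dominated bipartite graph with bipartition $V(G')=A\cup B$, $|A|<|B|$; a vertex $w\in B$ is strongly detachable if $G'-w$ is well-edge-dominated and every vertex of $N_{G'}(w)$ is a support vertex in $G'-w$. The house graph $\mathcal{H}$ has vertices $p_1,\dots,p_5$ and edges $p_1p_2,p_2p_3,p_3p_4,p_4p_1,p_3p_5,p_4p_5$. $\mathcal{F}$ is the family of graphs obtained from the disjoint union of $\mathcal{H}$ and a well-edge-dominated bipartite graph $G'$ with bipartition $A\cup B$, $|A|<|B|$, by identifying the vertex $p_5$ of $\mathcal{H}$ with a strongly detachable vertex $w\in B$ of $G'$. *)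

theory Defs
  imports Main
begin

(* An undirected edge is the set of its two endpoints. *)
datatype 'a ugraph = Graph (verts: "'a set") (edges: "'a set set")

definition simple_graph :: "'a ugraph \<Rightarrow> bool" where
  "simple_graph G \<longleftrightarrow>
     finite (verts G) \<and> (\<forall>e\<in>edges G. e \<subseteq> verts G \<and> card e = 2)"

definition degree :: "'a ugraph \<Rightarrow> 'a \<Rightarrow> nat" where
  "degree G v = card {e \<in> edges G. v \<in> e}"

definition neighbors :: "'a ugraph \<Rightarrow> 'a \<Rightarrow> 'a set" where
  "neighbors G v = {u. {v, u} \<in> edges G}"

definition support_vertex :: "'a ugraph \<Rightarrow> 'a \<Rightarrow> bool" where
  "support_vertex G v \<longleftrightarrow> v \<in> verts G \<and> (\<exists>u\<in>neighbors G v. degree G u = 1)"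

definition subgraph :: "'a ugraph \<Rightarrow> 'a ugraph \<Rightarrow> bool" where
  "subgraph H G \<longleftrightarrow> simple_graph H \<and> verts H \<subseteq> verts G \<and> edges H \<subseteq> edges G"

definition induced_subgraph :: "'a ugraph \<Rightarrow> 'a set \<Rightarrow> 'a ugraph" where
  "induced_subgraph G S = Graph (verts G \<inter> S) {e \<in> edges G. e \<subseteq> S}"

(* Since an edge f is the set of its endpoints, G - N_e[f] is delete_verts G f. *)
definition delete_verts :: "'a ugraph \<Rightarrow> 'a set \<Rightarrow> 'a ugraph" where
  "delete_verts G S = induced_subgraph G (verts G - S)"

definition reachable :: "'a ugraph \<Rightarrow> 'a \<Rightarrow> 'a \<Rightarrow> bool" where
  "reachable G u v \<longleftrightarrow> (u, v) \<in> {(a, b). {a, b} \<in> edges G}\<^sup>*"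

definition connected_graph :: "'a ugraph \<Rightarrow> bool" where
  "connected_graph G \<longleftrightarrow>
     verts G \<noteq> {} \<and> (\<forall>u\<in>verts G. \<forall>v\<in>verts G. reachable G u v)"

definition components :: "'a ugraph \<Rightarrow> 'a ugraph set" where
  "components G = {induced_subgraph G {u. reachable G v u} |v. v \<in> verts G}"

definition nontrivial :: "'a ugraph \<Rightarrow> bool" where
  "nontrivial G \<longleftrightarrow> 2 \<le> card (verts G)"

definition graph_iso :: "'a ugraph \<Rightarrow> 'b ugraph \<Rightarrow> bool" where
  "graph_iso G H \<longleftrightarrow>
     (\<exists>f. bij_betw f (verts G) (verts H) \<and>
       (\<forall>u\<in>verts G. \<forall>v\<in>verts G. {u, v} \<in> edges G \<longleftrightarrow> {f u, f v} \<in> edges H))"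

definition complete_graph :: "nat \<Rightarrow> nat ugraph" where
  "complete_graph n = Graph {..<n} {e. e \<subseteq> {..<n} \<and> card e = 2}"

definition triangle_of :: "'a ugraph \<Rightarrow> 'a ugraph \<Rightarrow> bool" where
  "triangle_of G T \<longleftrightarrow> subgraph T G \<and> graph_iso T (complete_graph 3)"

definition edge_dominating :: "'a ugraph \<Rightarrow> 'a set set \<Rightarrow> bool" where
  "edge_dominating G F \<longleftrightarrow>
     F \<subseteq> edges G \<and> (\<forall>e\<in>edges G. e \<in> F \<or> (\<exists>f\<in>F. e \<inter> f \<noteq> {}))"

definition minimal_edge_dominating :: "'a ugraph \<Rightarrow> 'a set set \<Rightarrow> bool" where
  "minimal_edge_dominating G F \<longleftrightarrow>
     edge_dominating G F \<and> (\<forall>F'. F' \<subset> F \<longrightarrow> \<not> edge_dominating G F')"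

definition well_edge_dominated :: "'a ugraph \<Rightarrow> bool" where
  "well_edge_dominated G \<longleftrightarrow>
     (\<forall>F F'. minimal_edge_dominating G F \<and> minimal_edge_dominating G F' \<longrightarrow>
        card F = card F')"

definition bipartition :: "'a ugraph \<Rightarrow> 'a set \<Rightarrow> 'a set \<Rightarrow> bool" where
  "bipartition G A B \<longleftrightarrow>
     verts G = A \<union> B \<and> A \<inter> B = {} \<and> (\<forall>e\<in>edges G. \<exists>a\<in>A. \<exists>b\<in>B. e = {a, b})"

definition strongly_detachable :: "'a ugraph \<Rightarrow> 'a set \<Rightarrow> 'a set \<Rightarrow> 'a \<Rightarrow> bool" where
  "strongly_detachable G A B w \<longleftrightarrow>
     simple_graph G \<and> well_edge_dominated G \<and> bipartition G A B \<and> card A < card B \<and>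
     w \<in> B \<and> well_edge_dominated (delete_verts G {w}) \<and>
     (\<forall>u\<in>neighbors G w. support_vertex (delete_verts G {w}) u)"

definition disjoint_union :: "'a ugraph \<Rightarrow> 'b ugraph \<Rightarrow> ('a + 'b) ugraph" where
  "disjoint_union G H =
     Graph (verts G <+> verts H) ((`) Inl ` edges G \<union> (`) Inr ` edges H)"

(* The resulting vertex is called u. A simple graph stays simple when u and v are not adjacent. *)
definition identify :: "'a \<Rightarrow> 'a \<Rightarrow> 'a ugraph \<Rightarrow> 'a ugraph" where
  "identify u v G =
     (let q = (\<lambda>x. if x = v then u else x) in Graph (q ` verts G) ((`) q ` edges G))"

(* Vertex i stands for p_i. *)
definition house :: "nat ugraph" where
  "house = Graph {1, 2, 3, 4, 5} {{1, 2}, {2, 3}, {3, 4}, {4, 1}, {3, 5}, {4, 5}}"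

(* Membership is up to isomorphism. Taking G' over the vertex type of G loses nothing,
   since G contains an isomorphic copy of G'. *)
definition house_family :: "'a ugraph set" where
  "house_family =
     {G. simple_graph G \<and>
        (\<exists>(G' :: 'a ugraph) A B w.
           simple_graph G' \<and> well_edge_dominated G' \<and> bipartition G' A B \<and> card A < card B \<and>
           strongly_detachable G' A B w \<and>
           graph_iso G (identify (Inl 5) (Inr w) (disjoint_union house G')))}"

end

theory Submission
  imports Defs
begin

text \<open>Let \<open>H\<close> be \<open>G\<close> without the triangle. Every maximal matching of \<open>H\<close> covers all neighbors of the
  triangle, and hence all of them have size one less than those of \<open>G\<close>. Exchanging matching edges
  of \<open>H\<close> for edges to the triangle shows that \<open>x\<close>, \<open>y\<close>, \<open>z\<close> have no neighbors in three distinct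
  components of \<open>H\<close>. Since some component misses each triangle vertex, one component \<open>C\<close> contains,
  up to symmetry, all neighbors of \<open>x\<close> and \<open>y\<close>, and none of \<open>z\<close>. Further exchanges show that \<open>C\<close> is
  bipartite between the neighbors of \<open>x\<close> and those of \<open>y\<close>, and edge dominating sets that contain a
  star inside \<open>C\<close> force \<open>C\<close> to be a single edge \<open>pq\<close>; this is the house. If a neighbor \<open>u\<close> of \<open>z\<close>
  were not a support vertex of the rest, some minimal edge dominating set of the rest would miss \<open>u\<close>,
  and adding the star \<open>{xp, xy, xz}\<close> would give one that is too large. Finally the rest together with
  \<open>z\<close> is triangle-free, and both it and its subgraph without \<open>z\<close> are equimatchable with the same
  matching number, which makes it bipartite with \<open>z\<close> in the larger class.\<close>

section \<open>Matchings and minimal edge dominating sets\<close>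

text \<open>Maximal matchings are special minimal edge dominating sets that are easy to modify, so
  most steps work with the fact that all of them have \<open>k\<close> edges. The full hypothesis is
  spent on the two star arguments, where the competing sets need not be matchings, and on its
  inheritance when matched vertices are deleted. The hypothesis on \<open>G - N_e[f]\<close> enters
  once: of two nontrivial components one avoids the third triangle vertex \<open>t\<close>, and
  connectedness gives it a vertex adjacent to an end of \<open>f\<close>. So some component of
  \<open>H\<close> meets the neighborhood of the triangle but contains no neighbor of
  \<open>t\<close>. The exchanges rest on an off-by-one: a matching of \<open>G\<close> as large as
  a maximal matching of \<open>H\<close> has only \<open>k - 1\<close> edges, so it leaves an edge
  untouched, and that edge must end at a vertex given up in the exchange. For bipartiteness the
  point is a vertex whose deletion preserves equimatchability; an induction can pass this property
  from \<open>t\<close> to its neighbors.\<close>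

text \<open>A graph is represented by its edge set alone: isolated vertices play no role for edge
  domination.\<close>

definition edge_set :: "'a set set \<Rightarrow> bool" where
  "edge_set E \<longleftrightarrow> finite E \<and> (\<forall>e\<in>E. card e = 2)"

definition del :: "'a set set \<Rightarrow> 'a set \<Rightarrow> 'a set set" where
  "del E S = {e \<in> E. e \<inter> S = {}}"

definition matching :: "'a set set \<Rightarrow> bool" where
  "matching M \<longleftrightarrow> (\<forall>e\<in>M. \<forall>f\<in>M. e \<noteq> f \<longrightarrow> e \<inter> f = {})"

definition maximal_matching :: "'a set set \<Rightarrow> 'a set set \<Rightarrow> bool" where
  "maximal_matching E M \<longleftrightarrow> M \<subseteq> E \<and> matching M \<and> (\<forall>e\<in>E. e \<inter> \<Union>M \<noteq> {})"

text \<open>Minimality is expressed by private edges: every \<open>e\<close> in \<open>F\<close> has an edge \<open>p\<close>, possibly \<open>e\<close> itself,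
  that no other member of \<open>F\<close> meets.\<close>

definition min_edge_dom :: "'a set set \<Rightarrow> 'a set set \<Rightarrow> bool" where
  "min_edge_dom E F \<longleftrightarrow> F \<subseteq> E \<and> (\<forall>e\<in>E. e \<inter> \<Union>F \<noteq> {}) \<and>
     (\<forall>e\<in>F. \<exists>p\<in>E. p \<inter> \<Union>(F - {e}) = {})"

definition well_dominated :: "'a set set \<Rightarrow> nat \<Rightarrow> bool" where
  "well_dominated E k \<longleftrightarrow> (\<forall>F. min_edge_dom E F \<longrightarrow> card F = k)"

definition equimatchable :: "'a set set \<Rightarrow> nat \<Rightarrow> bool" where
  "equimatchable E k \<longleftrightarrow> (\<forall>M. maximal_matching E M \<longrightarrow> card M = k)"

definition adj :: "'a set set \<Rightarrow> ('a \<times> 'a) set" where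
  "adj E = {(a, b). {a, b} \<in> E}"

text \<open>Only one color class is named, the other is its complement in the type. \<open>A\<close>
  may a priori contain elements on no edge; its cardinality excludes them later.\<close>

definition two_coloring :: "'a set set \<Rightarrow> 'a set \<Rightarrow> bool" where
  "two_coloring E A \<longleftrightarrow> (\<forall>e\<in>E. \<exists>a\<in>A. \<exists>b. b \<notin> A \<and> e = {a, b})"

definition trifree :: "'a set set \<Rightarrow> bool" where
  "trifree E \<longleftrightarrow> (\<forall>a b c. {a, b} \<in> E \<longrightarrow> {b, c} \<in> E \<longrightarrow> {a, c} \<notin> E)"

text \<open>Only vertices on edges have to be reachable. The edgeless graph thus counts as connected
  from every \<open>t\<close>, as the induction needs when a neighbor of \<open>t\<close> becomes
  isolated once \<open>t\<close> is deleted.\<close>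

definition conn_from :: "'a set set \<Rightarrow> 'a \<Rightarrow> bool" where
  "conn_from E t \<longleftrightarrow> (\<forall>v\<in>\<Union>E. (t, v) \<in> (adj E)\<^sup>*)"

lemma edge_setD:
  assumes "edge_set E" "e \<in> E"
  shows "e \<noteq> {}" "finite e" "card e = 2"
  using assms unfolding edge_set_def by (auto intro: card_ge_0_finite)

lemma edge_cases:
  assumes "edge_set E" "e \<in> E"
  obtains a b where "e = {a, b}" "a \<noteq> b"
  using edge_setD(3)[OF assms] by (auto simp: card_2_iff)

lemma edge_at:
  assumes "edge_set E" "e \<in> E" "v \<in> e"
  obtains w where "e = {v, w}" "v \<noteq> w"
  using edge_cases[OF assms(1,2)] assms(3) by (metis insertE insert_commute singletonD)

lemma edge_neq: "edge_set E \<Longrightarrow> {a, b} \<in> E \<Longrightarrow> a \<noteq> b"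
  using edge_setD(3)[of E "{a, b}"] by (cases "a = b") auto

lemma edge_set_mono: "edge_set E \<Longrightarrow> K \<subseteq> E \<Longrightarrow> edge_set K"
  unfolding edge_set_def by (auto intro: finite_subset)

lemma del_subset: "del E S \<subseteq> E"
  unfolding del_def by auto

lemma edge_set_del: "edge_set E \<Longrightarrow> edge_set (del E S)"
  using edge_set_mono del_subset by blast

lemma del_del: "del (del E S) T = del E (S \<union> T)"
  unfolding del_def by auto

lemma matching_eq: "matching M \<Longrightarrow> e \<in> M \<Longrightarrow> f \<in> M \<Longrightarrow> v \<in> e \<Longrightarrow> v \<in> f \<Longrightarrow> e = f"
  unfolding matching_def by blast

lemma matching_subset: "matching M \<Longrightarrow> N \<subseteq> M \<Longrightarrow> matching N"
  unfolding matching_def by blast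

lemma matching_insert: "matching M \<Longrightarrow> e \<inter> \<Union>M = {} \<Longrightarrow> matching (insert e M)"
  unfolding matching_def by blast

lemma matchingD: "matching M \<Longrightarrow> e \<in> M \<Longrightarrow> f \<in> M \<Longrightarrow> e \<noteq> f \<Longrightarrow> e \<inter> f = {}"
  unfolding matching_def by simp

lemma matching_Un:
  assumes "matching M" "matching N" "\<And>f. f \<in> N \<Longrightarrow> f \<inter> \<Union>M = {}"
  shows "matching (M \<union> N)"
  unfolding matching_def
proof (intro ballI impI)
  fix e f assume "e \<in> M \<union> N" "f \<in> M \<union> N" "e \<noteq> f"
  then consider "e \<in> M" "f \<in> M" | "e \<in> N" "f \<in> N" | "e \<in> M" "f \<in> N" | "e \<in> N" "f \<in> M"
    by blast
  then show "e \<inter> f = {}"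
  proof cases
    case 1 then show ?thesis using matchingD[OF assms(1)] \<open>e \<noteq> f\<close> by simp
  next
    case 2 then show ?thesis using matchingD[OF assms(2)] \<open>e \<noteq> f\<close> by simp
  next
    case 3 then show ?thesis using assms(3)[of f] by auto
  next
    case 4 then show ?thesis using assms(3)[of e] by auto
  qed
qed

lemma maximal_matchingD:
  assumes "maximal_matching E M"
  shows "M \<subseteq> E" "matching M" "e \<in> E \<Longrightarrow> e \<inter> \<Union>M \<noteq> {}"
  using assms unfolding maximal_matching_def by auto

lemma maximal_matchingI:
  assumes "M \<subseteq> E" "matching M" "\<And>e. e \<in> E \<Longrightarrow> e \<inter> \<Union>M \<noteq> {}"
  shows "maximal_matching E M"
  using assms unfolding maximal_matching_def by simp

lemma min_edge_domD:
  assumes "min_edge_dom E F"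
  shows "F \<subseteq> E" "e \<in> E \<Longrightarrow> e \<inter> \<Union>F \<noteq> {}" "e \<in> F \<Longrightarrow> \<exists>p\<in>E. p \<inter> \<Union>(F - {e}) = {}"
  using assms unfolding min_edge_dom_def by auto

lemma min_edge_domI:
  assumes "F \<subseteq> E" "\<And>e. e \<in> E \<Longrightarrow> e \<inter> \<Union>F \<noteq> {}"
    and "\<And>e. e \<in> F \<Longrightarrow> \<exists>p\<in>E. p \<inter> \<Union>(F - {e}) = {}"
  shows "min_edge_dom E F"
  using assms unfolding min_edge_dom_def by simp

lemma delD:
  assumes "e \<in> del E S"
  shows "e \<in> E" "e \<inter> S = {}"
  using assms unfolding del_def by auto

lemma delI: "e \<in> E \<Longrightarrow> e \<inter> S = {} \<Longrightarrow> e \<in> del E S"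
  unfolding del_def by simp

section \<open>Extension, deletion and restriction of maximal matchings\<close>

lemma maximal_matching_extend:
  assumes E: "edge_set E" and M: "M \<subseteq> E" "matching M"
  obtains M' where "M \<subseteq> M'" "maximal_matching E M'"
proof -
  let ?S = "{N. M \<subseteq> N \<and> N \<subseteq> E \<and> matching N}"
  have fin: "finite ?S"
    using E unfolding edge_set_def by (auto intro: finite_subset[of _ "Pow E"])
  have "M \<in> ?S" using M by auto
  from finite_has_maximal2[OF fin this] obtain N
    where N: "N \<in> ?S" "\<forall>N'\<in>?S. N \<subseteq> N' \<longrightarrow> N = N'" by (elim bexE conjE)
  have "maximal_matching E N"
  proof (rule maximal_matchingI)
    fix e assume e: "e \<in> E"
    show "e \<inter> \<Union>N \<noteq> {}"
    proof
      assume d: "e \<inter> \<Union>N = {}"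
      have "insert e N \<in> ?S" using N(1) e matching_insert[OF _ d] by auto
      from mp[OF bspec[OF N(2) this] subset_insertI] have "N = insert e N" .
      then show False using d edge_setD(1)[OF E e] by blast
    qed
  qed (use N in auto)
  then show thesis using that N(1) by blast
qed

lemma maximal_matching_exists:
  assumes "edge_set E"
  obtains M where "maximal_matching E M"
  using maximal_matching_extend[OF assms, of "{}"] unfolding matching_def by auto

lemma maximal_matching_min_edge_dom:
  assumes "maximal_matching E M"
  shows "min_edge_dom E M"
proof (rule min_edge_domI)
  show "\<exists>p\<in>E. p \<inter> \<Union>(M - {e}) = {}" if e: "e \<in> M" for e
  proof
    show "e \<in> E" using maximal_matchingD(1)[OF assms] e by auto
    show "e \<inter> \<Union>(M - {e}) = {}"
      using maximal_matchingD(2)[OF assms] e unfolding matching_def by auto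
  qed
qed (use maximal_matchingD[OF assms] in auto)

lemma well_dominated_equimatchable: "well_dominated E k \<Longrightarrow> equimatchable E k"
  unfolding well_dominated_def equimatchable_def using maximal_matching_min_edge_dom by blast

lemma finite_edges: "edge_set E \<Longrightarrow> F \<subseteq> E \<Longrightarrow> finite F"
  unfolding edge_set_def by (auto intro: finite_subset)

text \<open>A minimal edge dominating set \<open>F\<close> of the remaining graph becomes one of
  \<open>E\<close> by adding \<open>M\<close>: members of \<open>M\<close> are their own private
  edges, and the private edges of \<open>F\<close> survive because they avoid
  \<open>\<Union>M\<close>.\<close>

lemma well_dominated_del:
  assumes E: "edge_set E" "well_dominated E k" and M: "M \<subseteq> E" "matching M"
  shows "well_dominated (del E (\<Union>M)) (k - card M)" "card M \<le> k"
proof -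
  have *: "card M + card F = k" if F: "min_edge_dom (del E (\<Union>M)) F" for F
  proof -
    have FE: "F \<subseteq> E" using min_edge_domD(1)[OF F] del_subset by blast
    have d: "f \<inter> \<Union>M = {}" if "f \<in> F" for f using min_edge_domD(1)[OF F] that delD(2) by blast
    have "min_edge_dom E (M \<union> F)"
    proof (rule min_edge_domI)
      fix e assume e: "e \<in> E"
      show "e \<inter> \<Union>(M \<union> F) \<noteq> {}"
      proof (cases "e \<inter> \<Union>M = {}")
        case True
        then show ?thesis using min_edge_domD(2)[OF F delI[OF e True]] by auto
      qed auto
    next
      fix e assume e: "e \<in> M \<union> F"
      show "\<exists>p\<in>E. p \<inter> \<Union>(M \<union> F - {e}) = {}"
      proof (cases "e \<in> M")
        case True
        have "e \<inter> f = {}" if "f \<in> M \<union> F - {e}" for f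
          using that True M(2) d[of f] unfolding matching_def by auto
        then have "e \<inter> \<Union>(M \<union> F - {e}) = {}" by auto
        moreover have "e \<in> E" using True M(1) by auto
        ultimately show ?thesis by (rule bexI)
      next
        case False
        then obtain p where p: "p \<in> del E (\<Union>M)" "p \<inter> \<Union>(F - {e}) = {}"
          using min_edge_domD(3)[OF F, of e] e by auto
        have "p \<inter> \<Union>(M \<union> F - {e}) = {}" using p(2) delD(2)[OF p(1)] by auto
        then show ?thesis using delD(1)[OF p(1)] by (rule bexI)
      qed
    qed (use M FE in auto)
    then have "card (M \<union> F) = k" using E unfolding well_dominated_def by simp
    moreover have "M \<inter> F = {}" using d edge_setD(1)[OF E(1)] M by fastforce
    ultimately show ?thesis
      using card_Un_disjoint[of M F] finite_edges[OF E(1)] M FE by simp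
  qed
  obtain F where "maximal_matching (del E (\<Union>M)) F" using maximal_matching_exists[OF edge_set_del[OF E(1)]] .
  then show "card M \<le> k" using *[OF maximal_matching_min_edge_dom] by fastforce
  show "well_dominated (del E (\<Union>M)) (k - card M)" unfolding well_dominated_def using * by fastforce
qed

lemma equimatchable_del:
  assumes E: "edge_set E" "equimatchable E k" and M: "M \<subseteq> E" "matching M"
  shows "equimatchable (del E (\<Union>M)) (k - card M)" "card M \<le> k"
proof -
  have *: "card M + card F = k" if F: "maximal_matching (del E (\<Union>M)) F" for F
  proof -
    have FE: "F \<subseteq> E" using maximal_matchingD(1)[OF F] del_subset by blast
    have d: "f \<inter> \<Union>M = {}" if "f \<in> F" for f using maximal_matchingD(1)[OF F] that delD(2) by blast
    have "maximal_matching E (M \<union> F)"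
    proof (rule maximal_matchingI)
      show "matching (M \<union> F)"
        using matching_Un[OF M(2) maximal_matchingD(2)[OF F]] d by blast
      fix e assume e: "e \<in> E"
      show "e \<inter> \<Union>(M \<union> F) \<noteq> {}"
      proof (cases "e \<inter> \<Union>M = {}")
        case True
        then show ?thesis using maximal_matchingD(3)[OF F delI[OF e True]] by auto
      qed auto
    qed (use M FE in auto)
    then have "card (M \<union> F) = k" using E unfolding equimatchable_def by simp
    moreover have "M \<inter> F = {}" using d edge_setD(1)[OF E(1)] M by fastforce
    ultimately show ?thesis
      using card_Un_disjoint[of M F] finite_edges[OF E(1)] M FE by simp
  qed
  obtain F where "maximal_matching (del E (\<Union>M)) F" using maximal_matching_exists[OF edge_set_del[OF E(1)]] .
  then show "card M \<le> k" using * by fastforce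
  show "equimatchable (del E (\<Union>M)) (k - card M)" unfolding equimatchable_def using * by fastforce
qed

text \<open>An extension to a maximal matching also has \<open>k\<close> edges, so nothing was
  added. Exchanges therefore only have to preserve disjointness and size.\<close>

lemma equimatchable_maximal_matching:
  assumes E: "edge_set E" "equimatchable E k" and M: "M \<subseteq> E" "matching M" "card M = k"
  shows "maximal_matching E M"
proof -
  obtain M' where M': "M \<subseteq> M'" "maximal_matching E M'" using maximal_matching_extend[OF E(1) M(1,2)] by blast
  then have "card M' = k" "finite M'"
    using E finite_edges[OF E(1) maximal_matchingD(1)] unfolding equimatchable_def by auto
  then show ?thesis using M' M(3) card_subset_eq[of M' M] by simp
qed

text \<open>Deleting the vertices of a maximal matching of \<open>Q\<close> destroys every edge of
  \<open>Q\<close> and leaves \<open>P\<close> intact.\<close>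

lemma equimatchable_split:
  assumes E: "edge_set (P \<union> Q)" "equimatchable (P \<union> Q) k" and d: "\<Union>P \<inter> \<Union>Q = {}" and M0: "maximal_matching Q M0"
  shows "equimatchable P (k - card M0)" "card M0 \<le> k"
proof -
  have sub: "M0 \<subseteq> P \<union> Q" using maximal_matchingD(1)[OF M0] by auto
  show "card M0 \<le> k" using equimatchable_del(2)[OF E sub maximal_matchingD(2)[OF M0]] .
  have "p \<inter> \<Union>M0 = {}" if "p \<in> P" for p
    using that d maximal_matchingD(1)[OF M0] by blast
  then have "del (P \<union> Q) (\<Union>M0) = P"
    unfolding del_def using maximal_matchingD(3)[OF M0] by auto
  then show "equimatchable P (k - card M0)" using equimatchable_del(1)[OF E sub maximal_matchingD(2)[OF M0]] by simp
qed

lemma maximal_matching_restrict: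
  assumes M: "maximal_matching E M" and K: "K \<subseteq> E" and c: "\<And>e f. e \<in> K \<Longrightarrow> f \<in> E \<Longrightarrow> e \<inter> f \<noteq> {} \<Longrightarrow> f \<in> K"
  shows "maximal_matching K (M \<inter> K)"
proof (rule maximal_matchingI)
  show "e \<inter> \<Union>(M \<inter> K) \<noteq> {}" if e: "e \<in> K" for e
  proof -
    obtain f where f: "f \<in> M" "e \<inter> f \<noteq> {}" using maximal_matchingD(3)[OF M, of e] K e by auto
    then have "f \<in> K" using c[OF e] maximal_matchingD(1)[OF M] by auto
    then show ?thesis using f by auto
  qed
  show "matching (M \<inter> K)" using matching_subset[OF maximal_matchingD(2)[OF M]] by simp
qed simp

section \<open>Matchings in two-colored graphs\<close>

lemma two_coloring_cases:
  assumes "two_coloring E A" "e \<in> E"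
  obtains a b where "a \<in> A" "b \<notin> A" "e = {a, b}"
  using bspec[OF assms(1)[unfolded two_coloring_def] assms(2)] by auto

lemma two_coloring_card:
  assumes "two_coloring E A" and M: "M \<subseteq> E" "matching M"
  shows "card (A \<inter> \<Union>M) = card M" "card (\<Union>M - A) = card M"
proof -
  have "\<exists>p. fst p \<in> A \<and> snd p \<notin> A \<and> e = {fst p, snd p}" if e: "e \<in> M" for e
  proof -
    obtain a b where "a \<in> A" "b \<notin> A" "e = {a, b}" using two_coloring_cases[OF assms(1)] e M(1) by blast
    then show ?thesis by (intro exI[of _ "(a, b)"]) simp
  qed
  then obtain h where h: "\<And>e. e \<in> M \<Longrightarrow> fst (h e) \<in> A \<and> snd (h e) \<notin> A \<and> e = {fst (h e), snd (h e)}"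
    by metis
  define f g where "f e = fst (h e)" and "g e = snd (h e)" for e
  have fA: "f e \<in> A" "g e \<notin> A" "e = {f e, g e}" if "e \<in> M" for e
    using h[OF that] unfolding f_def g_def by simp_all
  have mem: "f e \<in> e" "g e \<in> e" if "e \<in> M" for e using fA(3)[OF that] by auto
  have inj: "inj_on f M" "inj_on g M"
    by (rule inj_onI, use matching_eq[OF M(2)] mem in metis)+
  have "A \<inter> \<Union>M = f ` M"
  proof
    show "f ` M \<subseteq> A \<inter> \<Union>M" using fA(1) mem by auto
    show "A \<inter> \<Union>M \<subseteq> f ` M"
    proof
      fix v assume "v \<in> A \<inter> \<Union>M"
      then obtain e where e: "e \<in> M" "v \<in> e" "v \<in> A" by auto
      then have "v = f e" using fA(2,3)[OF e(1)] by (metis insertE singletonD)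
      then show "v \<in> f ` M" using e by simp
    qed
  qed
  moreover have "\<Union>M - A = g ` M"
  proof
    show "g ` M \<subseteq> \<Union>M - A" using fA(2) mem by auto
    show "\<Union>M - A \<subseteq> g ` M"
    proof
      fix v assume "v \<in> \<Union>M - A"
      then obtain e where e: "e \<in> M" "v \<in> e" "v \<notin> A" by auto
      then have "v = g e" using fA(1,3)[OF e(1)] by (metis insertE singletonD)
      then show "v \<in> g ` M" using e by simp
    qed
  qed
  ultimately show "card (A \<inter> \<Union>M) = card M" "card (\<Union>M - A) = card M"
    using inj card_image by metis+
qed

text \<open>Each edge of \<open>M\<close> covers exactly one vertex of \<open>A\<close>, so equal
  cardinalities leave no vertex of \<open>A\<close> over.\<close>

lemma two_coloring_saturated:
  assumes "two_coloring E A" "M \<subseteq> E" "matching M" "finite A" "card M = card A"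
  shows "A \<subseteq> \<Union>M"
proof -
  have "card (A \<inter> \<Union>M) = card A" using two_coloring_card(1)[OF assms(1-3)] assms(5) by simp
  then have "A \<inter> \<Union>M = A" by (intro card_subset_eq) (use assms(4) in auto)
  then show ?thesis by blast
qed

lemma two_coloring_edge:
  assumes "two_coloring E A" "{u, v} \<in> E"
  shows "u \<in> A \<longleftrightarrow> v \<notin> A"
proof -
  obtain a b where "a \<in> A" "b \<notin> A" "{u, v} = {a, b}" using two_coloring_cases[OF assms] .
  then show ?thesis by (auto simp: doubleton_eq_iff)
qed

text \<open>If \<open>{b, w}\<close> were no edge, swapping \<open>{b, a}\<close>, \<open>{v, w}\<close> for \<open>{a, v}\<close> would leave \<open>w\<close> to be matched
  with a vertex other than \<open>b\<close>, giving a maximal matching that misses \<open>b\<close>.\<close>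

lemma path_closure:
  assumes K: "edge_set K" "equimatchable K j" "two_coloring K A" "finite A" "card A = j"
    and b: "b \<notin> A" and cov: "\<And>M. maximal_matching K M \<Longrightarrow> b \<in> \<Union>M"
    and path: "{b, a} \<in> K" "{a, v} \<in> K" "{v, w} \<in> K"
  shows "{b, w} \<in> K"
proof (cases "b = v \<or> a = w")
  case True
  then show ?thesis using path by auto
next
  case False
  have A: "a \<in> A" "v \<notin> A" "w \<in> A"
    using two_coloring_edge[OF K(3)] path b by blast+
  have ne: "b \<noteq> a" "a \<noteq> v" "v \<noteq> w" "b \<noteq> w" using A b by auto
  have "matching {{b, a}, {v, w}}" using False ne unfolding matching_def by auto
  then obtain M where M: "{{b, a}, {v, w}} \<subseteq> M" "maximal_matching K M"
    using maximal_matching_extend[OF K(1), of "{{b, a}, {v, w}}"] path by auto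
  let ?R = "M - {{b, a}, {v, w}}"
  have mM: "matching M" "M \<subseteq> K" using maximal_matchingD[OF M(2)] by auto
  have finM: "finite M" using finite_edges[OF K(1) mM(2)] .
  have cM: "card M = j" using K(2) M(2) unfolding equimatchable_def by blast
  have sat: "A \<subseteq> \<Union>M" using two_coloring_saturated[OF K(3) mM(2,1) K(4)] cM K(5) by simp
  have R: "b \<notin> \<Union>?R" "a \<notin> \<Union>?R" "v \<notin> \<Union>?R" "w \<notin> \<Union>?R"
    using M(1) matching_eq[OF mM(1), of "{b, a}"] matching_eq[OF mM(1), of "{v, w}"] by auto
  have cR: "card ?R = j - 2" "2 \<le> j"
  proof -
    have "{b, a} \<noteq> {v, w}" using False ne by auto
    then have c2: "card {{b, a}, {v, w}} = 2" by simp
    show "card ?R = j - 2" using card_Diff_subset[OF _ M(1)] c2 cM by simp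
    show "2 \<le> j" using card_mono[OF finM M(1)] c2 cM by simp
  qed
  have mR: "matching ?R" using matching_subset[OF mM(1)] by auto
  have mav: "matching (insert {a, v} ?R)" using matching_insert[OF mR, of "{a, v}"] R by auto
  have avR: "{a, v} \<notin> ?R" using R by auto
  have c1: "card (insert {a, v} ?R) = j - 1" using cR avR finM by simp
  \<comment> \<open>Two edges were traded for one, so the result is one edge too small to be
    maximal.\<close>
  have "\<not> maximal_matching K (insert {a, v} ?R)"
  proof
    assume "maximal_matching K (insert {a, v} ?R)"
    then have "card (insert {a, v} ?R) = j" using K(2) unfolding equimatchable_def by blast
    then show False using c1 cR by linarith
  qed
  moreover have "insert {a, v} ?R \<subseteq> K" using mM path by auto
  ultimately obtain e where e: "e \<in> K" "e \<inter> \<Union>(insert {a, v} ?R) = {}"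
    using maximal_matchingI[OF _ mav, of K] by metis
  obtain p q where pq: "p \<in> A" "q \<notin> A" "e = {p, q}" using two_coloring_cases[OF K(3) e(1)] .
  \<comment> \<open>The endpoint of \<open>e\<close> in \<open>A\<close> is covered by
    \<open>M\<close> but no longer after the swap; only \<open>w\<close> qualifies.\<close>
  have "p \<in> \<Union>M" using sat pq by auto
  then obtain m where m: "m \<in> M" "p \<in> m" by auto
  have "m \<notin> ?R" using e(2) pq m by auto
  then have "p \<in> {a, b, v, w}" using m by auto
  moreover have "p \<noteq> a" using e(2) pq by auto
  ultimately have "p = w" using pq A b by auto
  show ?thesis
  proof (cases "q = b")
    case True
    then show ?thesis using e pq \<open>p = w\<close> by (simp add: insert_commute)
  next
    case False
    let ?M = "insert {w, q} (insert {a, v} ?R)"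
    have "matching ?M" using matching_insert[OF mav] e(2) pq \<open>p = w\<close> by simp
    moreover have "card ?M = j"
    proof -
      have "{w, q} \<notin> insert {a, v} ?R"
      proof
        assume "{w, q} \<in> insert {a, v} ?R"
        then have "w \<in> \<Union>(insert {a, v} ?R)" by auto
        then show False using e(2) pq \<open>p = w\<close> by auto
      qed
      from card_insert_disjoint[OF _ this] have "card ?M = Suc (j - 1)"
        using finM c1 by simp
      then show ?thesis using cR by simp
    qed
    moreover have "?M \<subseteq> K" using e pq \<open>p = w\<close> path mM by auto
    ultimately have "maximal_matching K ?M" by (intro equimatchable_maximal_matching[OF K(1,2)])
    then have "b \<in> \<Union>?M" by (rule cov)
    then show ?thesis using R False ne \<open>\<not> (b = v \<or> a = w)\<close> by auto
  qed
qed

text \<open>Walks from \<open>b\<close> are shortened two steps at a time by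
  \<open>path_closure\<close>, so \<open>b\<close> is adjacent to every vertex of \<open>A\<close>
  in its component. The second conjunct carries a path of length two to the vertices outside
  \<open>A\<close> through the induction.\<close>

lemma unmissed_adjacent:
  assumes K: "edge_set K" "equimatchable K j" "two_coloring K A" "finite A" "card A = j"
    and b: "b \<notin> A" and cov: "\<And>M. maximal_matching K M \<Longrightarrow> b \<in> \<Union>M"
    and "(b, v) \<in> (adj K)\<^sup>*"
  shows "(v \<in> A \<longrightarrow> {b, v} \<in> K) \<and> (v \<notin> A \<longrightarrow> v = b \<or> (\<exists>a. {b, a} \<in> K \<and> {a, v} \<in> K))"
  using assms(8)
proof (induction rule: rtrancl_induct)
  case base
  then show ?case using b by auto
next
  case (step v w)
  then have vw: "{v, w} \<in> K" unfolding adj_def by auto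
  show ?case
  proof (cases "v \<in> A")
    case True
    then show ?thesis using step.IH vw two_coloring_edge[OF K(3) vw] by blast
  next
    case False
    then have "w \<in> A" using two_coloring_edge[OF K(3) vw] by blast
    then show ?thesis
      using step.IH False vw path_closure[OF K b cov] by metis
  qed
qed

section \<open>Triangle-free equimatchable graphs\<close>

definition component_edges :: "'a set set \<Rightarrow> 'a \<Rightarrow> 'a set set" where
  "component_edges E s = {e \<in> E. \<exists>v\<in>e. (s, v) \<in> (adj E)\<^sup>*}"

lemma adj_iff: "(a, b) \<in> adj E \<longleftrightarrow> {a, b} \<in> E"
  unfolding adj_def by simp

lemma reach_sym: "(a, b) \<in> (adj E)\<^sup>* \<Longrightarrow> (b, a) \<in> (adj E)\<^sup>*"
  by (rule symD[OF sym_rtrancl]) (auto simp: sym_def adj_iff insert_commute)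

lemma adj_mono: "K \<subseteq> E \<Longrightarrow> (a, b) \<in> (adj K)\<^sup>* \<Longrightarrow> (a, b) \<in> (adj E)\<^sup>*"
  using rtrancl_mono[of "adj K" "adj E"] unfolding adj_def by auto

lemma component_edges_subset: "component_edges E s \<subseteq> E"
  unfolding component_edges_def by auto

lemma component_edges_reach:
  assumes E: "edge_set E" and e: "e \<in> component_edges E s" "w \<in> e"
  shows "(s, w) \<in> (adj E)\<^sup>*"
proof -
  obtain v where v: "e \<in> E" "v \<in> e" "(s, v) \<in> (adj E)\<^sup>*" using e unfolding component_edges_def by auto
  show ?thesis
  proof (cases "v = w")
    case False
    obtain u where "e = {v, u}" using edge_at[OF E v(1,2)] by metis
    then have "(v, w) \<in> adj E" using v e False by (auto simp: adj_iff)
    then show ?thesis using v(3) by simp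
  qed (use v in simp)
qed

lemma component_edgesI: "e \<in> E \<Longrightarrow> v \<in> e \<Longrightarrow> (s, v) \<in> (adj E)\<^sup>* \<Longrightarrow> e \<in> component_edges E s"
  unfolding component_edges_def by auto

lemma component_edges_closed:
  assumes "edge_set E" "e \<in> component_edges E s" "f \<in> E" "e \<inter> f \<noteq> {}"
  shows "f \<in> component_edges E s"
  using assms component_edges_reach[OF assms(1,2)] component_edgesI by fastforce

lemma component_edges_eq:
  assumes "(s, t) \<in> (adj E)\<^sup>*"
  shows "component_edges E s = component_edges E t"
proof -
  have "(s, v) \<in> (adj E)\<^sup>* \<longleftrightarrow> (t, v) \<in> (adj E)\<^sup>*" for v
    using rtrancl_trans[OF assms] rtrancl_trans[OF reach_sym[OF assms]] by blast
  then show ?thesis unfolding component_edges_def by simp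
qed

lemma component_edges_eq_vertex:
  assumes "edge_set E" "v \<in> \<Union>(component_edges E s)"
  shows "component_edges E v = component_edges E s"
  using component_edges_eq[of s v E] component_edges_reach[OF assms(1)] assms(2) by auto

lemma component_edges_conn:
  assumes E: "edge_set E"
  shows "conn_from (component_edges E s) s"
proof -
  have "(s, v) \<in> (adj (component_edges E s))\<^sup>*" if "(s, v) \<in> (adj E)\<^sup>*" for v
    using that
  proof (induction rule: rtrancl_induct)
    case (step v w)
    then have "{v, w} \<in> component_edges E s" using component_edgesI[of "{v, w}" E v s] by (simp add: adj_iff)
    then show ?case using step.IH by (simp add: adj_iff rtrancl_into_rtrancl)
  qed simp
  then show ?thesis unfolding conn_from_def using component_edges_reach[OF E] by auto
qed

lemma component_edges_split:
  assumes E: "edge_set E"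
  shows "\<Union>(component_edges E s) \<inter> \<Union>(E - component_edges E s) = {}"
  using component_edges_closed[OF E, of _ s] by auto

lemma equimatchable_unique:
  assumes "edge_set E" "equimatchable E j" "equimatchable E k"
  shows "j = k"
  using maximal_matching_exists[OF assms(1)] assms(2,3) unfolding equimatchable_def by metis

text \<open>A maximal matching that misses \<open>b\<close> stays maximal after deletion of
  \<open>b\<close>. Hence if deleting \<open>b\<close> lowers the matching number, every maximal
  matching covers \<open>b\<close>.\<close>

lemma equimatchable_missed:
  assumes "maximal_matching K M" "b \<notin> \<Union>M" "equimatchable (del K {b}) j"
  shows "card M = j"
proof -
  have "maximal_matching (del K {b}) M"
  proof (rule maximal_matchingI)
    show "M \<subseteq> del K {b}" using maximal_matchingD(1)[OF assms(1)] assms(2) unfolding del_def by auto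
    show "matching M" using maximal_matchingD(2)[OF assms(1)] .
    show "e \<inter> \<Union>M \<noteq> {}" if "e \<in> del K {b}" for e
      using maximal_matchingD(3)[OF assms(1) delD(1)[OF that]] .
  qed
  then show ?thesis using assms(3) unfolding equimatchable_def by simp
qed

text \<open>Different \<open>s\<close> may share a component, so the classes are chosen per
  component and not per \<open>s\<close>. Each class has the size of a maximal matching, hence is
  saturated by it and stays inside its own component; saturation by a maximal matching of
  \<open>E\<close> also gives the total size. \<open>Q\<close> transports which neighbors of the
  deleted vertex lie in the class.\<close>

lemma two_coloring_glue:
  assumes E: "edge_set E" "equimatchable E k"
    and cov: "\<And>e. e \<in> E \<Longrightarrow> \<exists>s\<in>S. e \<in> component_edges E s"
    and loc: "\<And>s. s \<in> S \<Longrightarrow>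
      \<exists>A. finite A \<and> equimatchable (component_edges E s) (card A) \<and> two_coloring (component_edges E s) A \<and> Q (component_edges E s) A"
  obtains A where "finite A" "two_coloring E A" "card A = k" "A \<subseteq> \<Union>E"
    and "\<forall>s\<in>S. Q (component_edges E s) (A \<inter> \<Union>(component_edges E s))"
proof -
  define KK where "KK = component_edges E ` S"
  have "\<forall>K\<in>KK. \<exists>A. finite A \<and> equimatchable K (card A) \<and> two_coloring K A \<and> Q K A"
    unfolding KK_def using loc by simp
  then obtain f where f: "\<And>K. K \<in> KK \<Longrightarrow> finite (f K) \<and> equimatchable K (card (f K)) \<and> two_coloring K (f K) \<and> Q K (f K)"
    by metis
  have KE: "K \<subseteq> E" if "K \<in> KK" for K using that component_edges_subset[of E] unfolding KK_def by auto
  have sat: "f K \<subseteq> \<Union>M" if "K \<in> KK" "maximal_matching K M" for K M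
    using two_coloring_saturated[of K "f K" M] f[OF that(1)] maximal_matchingD[OF that(2)] that(2)
    unfolding equimatchable_def by simp
  have fK: "f K \<subseteq> \<Union>K" if K: "K \<in> KK" for K
  proof -
    obtain M where M: "maximal_matching K M" using maximal_matching_exists[OF edge_set_mono[OF E(1) KE[OF K]]] .
    show ?thesis using sat[OF K M] maximal_matchingD(1)[OF M] by auto
  qed
  have disj: "K = K'" if "K \<in> KK" "K' \<in> KK" "v \<in> \<Union>K" "v \<in> \<Union>K'" for K K' v
    using that component_edges_eq_vertex[OF E(1), of v] unfolding KK_def by auto
  define A where "A = (\<Union>K\<in>KK. f K)"
  have AK: "A \<inter> \<Union>K = f K" if K: "K \<in> KK" for K
  proof
    show "f K \<subseteq> A \<inter> \<Union>K" using fK[OF K] K unfolding A_def by auto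
    show "A \<inter> \<Union>K \<subseteq> f K"
    proof
      fix v assume v: "v \<in> A \<inter> \<Union>K"
      then obtain K' where K': "K' \<in> KK" "v \<in> f K'" unfolding A_def by auto
      then have "v \<in> \<Union>K'" using fK[OF K'(1)] by auto
      then have "K' = K" using disj[OF K'(1) K] v by auto
      then show "v \<in> f K" using K' by simp
    qed
  qed
  have AE: "A \<subseteq> \<Union>E"
  proof
    fix v assume "v \<in> A"
    then obtain K where "K \<in> KK" "v \<in> f K" unfolding A_def by auto
    then show "v \<in> \<Union>E" using fK KE by (meson Union_mono subsetD)
  qed
  have finA: "finite A"
    using finite_subset[OF AE] finite_Union[of E] finite_edges[OF E(1)] edge_setD(2)[OF E(1)] by auto
  have two_coloringA: "two_coloring E A"
    unfolding two_coloring_def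
  proof
    fix e assume e: "e \<in> E"
    then obtain s where s: "s \<in> S" "e \<in> component_edges E s" using cov by auto
    then have K: "component_edges E s \<in> KK" unfolding KK_def by auto
    have "two_coloring (component_edges E s) (f (component_edges E s))" using f[OF K] by simp
    then obtain a b where ab: "a \<in> f (component_edges E s)" "b \<notin> f (component_edges E s)" "e = {a, b}"
      using two_coloring_cases s(2) by metis
    have "a \<in> A" using AK[OF K] ab by auto
    moreover have "b \<notin> A" using AK[OF K] ab s(2) by auto
    ultimately show "\<exists>a\<in>A. \<exists>b. b \<notin> A \<and> e = {a, b}" using ab(3) by auto
  qed
  obtain M where M: "maximal_matching E M" using maximal_matching_exists[OF E(1)] .
  have "A \<subseteq> \<Union>M"
  proof
    fix v assume "v \<in> A"
    then obtain K where K: "K \<in> KK" "v \<in> f K" unfolding A_def by auto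
    have "maximal_matching K (M \<inter> K)"
    proof (rule maximal_matching_restrict[OF M KE[OF K(1)]])
      show "f \<in> K" if "e \<in> K" "f \<in> E" "e \<inter> f \<noteq> {}" for e f
        using that K(1) component_edges_closed[OF E(1)] unfolding KK_def by auto
    qed
    then have "f K \<subseteq> \<Union>(M \<inter> K)" by (rule sat[OF K(1)])
    then show "v \<in> \<Union>M" using K(2) by auto
  qed
  then have "card M = card A"
    using two_coloring_card(1)[OF two_coloringA maximal_matchingD(1,2)[OF M]] by (simp add: inf.absorb1)
  then have "card A = k" using E(2) M unfolding equimatchable_def by simp
  moreover have "Q (component_edges E s) (A \<inter> \<Union>(component_edges E s))" if "s \<in> S" for s
  proof -
    have "component_edges E s \<in> KK" using that unfolding KK_def by simp
    then show ?thesis using AK f by simp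
  qed
  ultimately show thesis by (intro that[OF finA two_coloringA _ AE] ballI)
qed

text \<open>Fix a maximal matching \<open>M0\<close> of the other components. In
  \<open>E - t\<close> this leaves the component of \<open>s\<close> with number
  \<open>k - |M0|\<close>; after deleting both ends of \<open>{t, s}\<close> from \<open>E\<close>
  it leaves that component without \<open>s\<close>, with number \<open>l - 1 - |M0|\<close>. The
  last equation eliminates \<open>M0\<close> without subtraction: \<open>l = k\<close> gives
  \<open>j = Suc j'\<close>, and \<open>l = Suc k\<close> gives \<open>j = j'\<close>.\<close>

lemma equimatchable_local:
  assumes E: "edge_set E" "equimatchable E l" "equimatchable (del E {t}) k" and ts: "{t, s} \<in> E"
  obtains j j' where "equimatchable (component_edges (del E {t}) s) j" "equimatchable (del (component_edges (del E {t}) s) {s}) j'"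
    "j + l = Suc (k + j')"
proof -
  let ?E = "del E {t}"
  let ?K = "component_edges ?E s" and ?R = "?E - component_edges ?E s"
  have E': "edge_set ?E" using edge_set_del[OF E(1)] .
  have U: "?K \<union> ?R = ?E" using component_edges_subset[of ?E s] by auto
  obtain M0 where M0: "maximal_matching ?R M0" using maximal_matching_exists[OF edge_set_mono[OF E', of ?R]] by auto
  have 1: "equimatchable ?K (k - card M0)" "card M0 \<le> k"
    using equimatchable_split[of ?K ?R k M0] U E' E(3) component_edges_split[OF E'] M0 by simp_all
  have m: "matching {{t, s}}" unfolding matching_def by simp
  have "equimatchable (del E (\<Union>{{t, s}})) (l - 1)" "1 \<le> l"
    using equimatchable_del[OF E(1,2) _ m] ts by simp_all
  moreover have "del E (\<Union>{{t, s}}) = del ?K {s} \<union> ?R"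
  proof -
    have "del E (\<Union>{{t, s}}) = del ?E {s}" by (simp add: del_del insert_commute)
    moreover have "s \<notin> f" if "f \<in> ?R" for f
      using that component_edgesI[of f ?E s s] by auto
    moreover have "del ?E {s} = del ?K {s} \<union> del ?R {s}" using U unfolding del_def by auto
    moreover have "del ?R {s} = ?R" using calculation(2) unfolding del_def[of ?R] by auto
    ultimately show ?thesis by simp
  qed
  moreover have "\<Union>(del ?K {s}) \<inter> \<Union>?R = {}"
    using component_edges_split[OF E', of s] del_subset[of ?K "{s}"] by auto
  ultimately have 2: "equimatchable (del ?K {s}) (l - 1 - card M0)" "card M0 \<le> l - 1"
    using equimatchable_split[of "del ?K {s}" ?R "l - 1" M0] edge_set_del[OF E(1)] M0 by metis+
  show thesis using that[OF 1(1) 2(1)] 1(2) 2(2) \<open>1 \<le> l\<close> by linarith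
qed

text \<open>Cut the walk after its last visit to \<open>t\<close>.\<close>

lemma conn_from_del:
  assumes "(t, v) \<in> (adj E)\<^sup>*" "v \<noteq> t"
  shows "\<exists>s. {t, s} \<in> E \<and> (s, v) \<in> (adj (del E {t}))\<^sup>*"
proof -
  have "v = t \<or> (\<exists>s. {t, s} \<in> E \<and> (s, v) \<in> (adj (del E {t}))\<^sup>*)"
    using assms(1)
  proof (induction rule: rtrancl_induct)
    case (step v w)
    then have vw: "{v, w} \<in> E" by (simp add: adj_iff)
    consider "w = t" | "w \<noteq> t" "v = t" | "w \<noteq> t" "v \<noteq> t" by blast
    then show ?case
    proof cases
      case 3
      then obtain s where s: "{t, s} \<in> E" "(s, v) \<in> (adj (del E {t}))\<^sup>*" using step.IH by auto
      have "(v, w) \<in> adj (del E {t})" using vw 3 by (simp add: adj_iff del_def)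
      then show ?thesis using s by (meson rtrancl_into_rtrancl)
    qed (use vw in auto)
  qed simp
  then show ?thesis using assms(2) by blast
qed

text \<open>The two claims are proved by a mutual induction: deleting an edge \<open>{t, s}\<close> shows that, in the
  component of \<open>s\<close> in \<open>E - t\<close>, removing \<open>s\<close> lowers the matching number iff removing \<open>t\<close> does not
  lower that of \<open>E\<close>. Color classes of distinct components are then glued.\<close>

theorem equimatchable_two_coloring:
  assumes "edge_set E" "trifree E" "conn_from E t" "equimatchable (del E {t}) k"
  shows "(equimatchable E k \<longrightarrow> (\<exists>A. finite A \<and> two_coloring E A \<and> t \<notin> A \<and> card A = k)) \<and>
    (equimatchable E (Suc k) \<longrightarrow> (\<exists>A. finite A \<and> two_coloring E A \<and> t \<in> A \<and> card A = Suc k))"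
  using assms
proof (induction "card E" arbitrary: E t k rule: less_induct)
  case less
  note E = less.prems
  let ?E = "del E {t}" and ?N = "{s. {t, s} \<in> E}"
  have E': "edge_set ?E" using edge_set_del[OF E(1)] .
  have te: "e \<in> E \<Longrightarrow> t \<in> e \<Longrightarrow> \<exists>s\<in>?N. e = {t, s}" for e
    using edge_at[OF E(1), of e t] by (metis mem_Collect_eq)
  have cov: "\<exists>s\<in>?N. e \<in> component_edges ?E s" if e: "e \<in> ?E" for e
  proof -
    obtain v where v: "v \<in> e" using edge_setD(1)[OF E' e] by auto
    have "(t, v) \<in> (adj E)\<^sup>*" "v \<noteq> t"
      using E(3) v delD[OF e] unfolding conn_from_def by auto
    then obtain s where "{t, s} \<in> E" "(s, v) \<in> (adj ?E)\<^sup>*" using conn_from_del by metis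
    then show ?thesis using component_edgesI[OF e v] by auto
  qed
  have IH: "(equimatchable K j' \<longrightarrow> (\<exists>A. finite A \<and> two_coloring K A \<and> s \<notin> A \<and> card A = j')) \<and>
    (equimatchable K (Suc j') \<longrightarrow> (\<exists>A. finite A \<and> two_coloring K A \<and> s \<in> A \<and> card A = Suc j'))"
    if s: "s \<in> ?N" and K: "K = component_edges ?E s" and j: "equimatchable (del K {s}) j'" for s K j'
  proof (rule less.hyps)
    have sub: "K \<subseteq> E" "{t, s} \<notin> K" using component_edges_subset[of ?E s] del_subset[of E "{t}"] K
      by (auto simp: del_def)
    then have "K \<subset> E" using s by auto
    then show "card K < card E" using E(1) unfolding edge_set_def by (simp add: psubset_card_mono)
    show "edge_set K" using edge_set_mono[OF E(1) sub(1)] .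
    show "trifree K" using E(2) sub(1) unfolding trifree_def by (meson subsetD)
    show "conn_from K s" using component_edges_conn[OF E'] K by simp
  qed (use j in simp)
  show ?case
  proof (intro conjI impI)
    assume k: "equimatchable E k"
    \<comment> \<open>In this case \<open>t\<close> ends up outside \<open>A\<close>, so all its
      neighbors must lie in \<open>A\<close>, including those that share a component with
      \<open>s\<close>.\<close>
    let ?Q = "\<lambda>K A. \<forall>s\<in>?N. component_edges ?E s = K \<longrightarrow> s \<in> A"
    have "\<exists>A. finite A \<and> equimatchable (component_edges ?E s) (card A) \<and> two_coloring (component_edges ?E s) A \<and> ?Q (component_edges ?E s) A"
      if s: "s \<in> ?N" for s
    proof -
      let ?K = "component_edges ?E s"
      have K: "edge_set ?K" using edge_set_mono[OF E' component_edges_subset] .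
      obtain j' where j: "equimatchable ?K (Suc j')" "equimatchable (del ?K {s}) j'"
        using equimatchable_local[OF E(1) k E(4), of s] s by auto
      then obtain A where A: "finite A" "two_coloring ?K A" "s \<in> A" "card A = Suc j'"
        using IH[OF s refl j(2)] by auto
      have "?Q ?K A"
      proof (intro ballI impI, rule ccontr)
        \<comment> \<open>Deleting \<open>r\<close> lowers the matching number of the component, so
          every maximal matching covers \<open>r\<close>. Outside \<open>A\<close>, it would then be
          adjacent to \<open>s\<close>, closing a triangle with \<open>t\<close>.\<close>
        fix r assume r: "r \<in> ?N" "component_edges ?E r = ?K" "r \<notin> A"
        obtain i' where i: "equimatchable ?K (Suc i')" "equimatchable (del ?K {r}) i'"
          using equimatchable_local[OF E(1) k E(4), of r] r by auto
        have "i' = j'" using equimatchable_unique[OF K i(1) j(1)] by simp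
        have "r \<in> \<Union>M" if "maximal_matching ?K M" for M
        proof (rule ccontr)
          assume "r \<notin> \<Union>M"
          then have "card M = i'" using equimatchable_missed[OF that _ i(2)] by blast
          then show False using i(1) that unfolding equimatchable_def by auto
        qed
        note cov = this
        obtain M where M: "maximal_matching ?K M" using maximal_matching_exists[OF K] .
        have "card M = card A" using j(1) M A(4) unfolding equimatchable_def by simp
        then have "s \<in> \<Union>?K"
          using two_coloring_saturated[OF A(2) maximal_matchingD(1,2)[OF M] A(1)] A(3) maximal_matchingD(1)[OF M] by auto
        moreover have "conn_from ?K r" using component_edges_conn[OF E', of r] r(2) by simp
        ultimately have "(r, s) \<in> (adj ?K)\<^sup>*" unfolding conn_from_def by blast
        then have "{r, s} \<in> ?K"
          using unmissed_adjacent[OF K j(1) A(2,1,4) r(3) cov] A(3) by blast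
        then have "{r, s} \<in> E" using component_edges_subset del_subset by (meson subsetD)
        then show False using E(2) r(1) s unfolding trifree_def by auto
      qed
      then show ?thesis using A j by auto
    qed
    note loc = this
    obtain A where A: "finite A" "two_coloring ?E A" "card A = k" "A \<subseteq> \<Union>?E"
      "\<forall>s\<in>?N. ?Q (component_edges ?E s) (A \<inter> \<Union>(component_edges ?E s))"
      by (rule two_coloring_glue[where Q = ?Q, OF E' E(4) cov loc])
    have t: "t \<notin> A" using A(4) delD(2)[of _ E "{t}"] by auto
    have "two_coloring E A"
      unfolding two_coloring_def
    proof
      fix e assume e: "e \<in> E"
      show "\<exists>a\<in>A. \<exists>b. b \<notin> A \<and> e = {a, b}"
      proof (cases "t \<in> e")
        case True
        then obtain s where s: "s \<in> ?N" "e = {t, s}" using te[OF e] by auto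
        then show ?thesis using A(5) s(1) t by (intro bexI[of _ s] exI[of _ t]) auto
      next
        case False
        then show ?thesis using A(2) delI[OF e, of "{t}"] unfolding two_coloring_def by auto
      qed
    qed
    then show "\<exists>A. finite A \<and> two_coloring E A \<and> t \<notin> A \<and> card A = k" using A t by auto
  next
    assume k: "equimatchable E (Suc k)"
    let ?Q = "\<lambda>K A. \<forall>s\<in>?N. component_edges ?E s = K \<longrightarrow> s \<notin> A"
    have "\<exists>A. finite A \<and> equimatchable (component_edges ?E s) (card A) \<and> two_coloring (component_edges ?E s) A \<and> ?Q (component_edges ?E s) A"
      if s: "s \<in> ?N" for s
    proof -
      let ?K = "component_edges ?E s"
      have K: "edge_set ?K" using edge_set_mono[OF E' component_edges_subset] .
      obtain j where j: "equimatchable ?K j" "equimatchable (del ?K {s}) j"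
        using equimatchable_local[OF E(1) k E(4), of s] s by auto
      then obtain A where A: "finite A" "two_coloring ?K A" "s \<notin> A" "card A = j"
        using IH[OF s refl j(2)] by auto
      \<comment> \<open>Deleting \<open>r\<close> keeps the matching number, so some matching of
        that size saturates \<open>A\<close> while missing \<open>r\<close>.\<close>
      have "?Q ?K A"
      proof (intro ballI impI)
        fix r assume r: "r \<in> ?N" "component_edges ?E r = ?K"
        obtain i where i: "equimatchable ?K i" "equimatchable (del ?K {r}) i"
          using equimatchable_local[OF E(1) k E(4), of r] r by auto
        have ij: "i = j" using equimatchable_unique[OF K i(1) j(1)] .
        obtain M where M: "maximal_matching (del ?K {r}) M" using maximal_matching_exists[OF edge_set_del[OF K]] .
        then have "card M = card A" using i(2) ij A(4) unfolding equimatchable_def by simp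
        moreover have "M \<subseteq> ?K" using maximal_matchingD(1)[OF M] del_subset[of ?K "{r}"] by auto
        ultimately have "A \<subseteq> \<Union>M" using two_coloring_saturated[OF A(2) _ maximal_matchingD(2)[OF M] A(1)] by simp
        moreover have "r \<notin> \<Union>M" using maximal_matchingD(1)[OF M] unfolding del_def by auto
        ultimately show "r \<notin> A" by auto
      qed
      then show ?thesis using A j by auto
    qed
    note loc = this
    obtain A where A: "finite A" "two_coloring ?E A" "card A = k" "A \<subseteq> \<Union>?E"
      "\<forall>s\<in>?N. ?Q (component_edges ?E s) (A \<inter> \<Union>(component_edges ?E s))"
      by (rule two_coloring_glue[where Q = ?Q, OF E' E(4) cov loc])
    have t: "t \<notin> A" using A(4) delD(2)[of _ E "{t}"] by auto
    \<comment> \<open>\<open>Q\<close> only speaks of the part of \<open>A\<close> inside the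
      component. A vertex of \<open>A\<close> lies on an edge, hence inside its own
      component.\<close>
    have NA: "s \<notin> A" if s: "s \<in> ?N" for s
    proof
      assume "s \<in> A"
      then obtain e where e: "e \<in> ?E" "s \<in> e" using A(4) by auto
      then have "s \<in> \<Union>(component_edges ?E s)" using component_edgesI[OF e] by auto
      then show False using A(5) s \<open>s \<in> A\<close> by auto
    qed
    have "two_coloring E (insert t A)"
      unfolding two_coloring_def
    proof
      fix e assume e: "e \<in> E"
      show "\<exists>a\<in>insert t A. \<exists>b. b \<notin> insert t A \<and> e = {a, b}"
      proof (cases "t \<in> e")
        case True
        then obtain s where s: "s \<in> ?N" "e = {t, s}" using te[OF e] by auto
        moreover have "s \<noteq> t" using edge_neq[OF E(1)] s(1) by auto
        ultimately show ?thesis using NA[OF s(1)] by auto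
      next
        case False
        then have "e \<in> ?E" using e unfolding del_def by simp
        then obtain a b where ab: "a \<in> A" "b \<notin> A" "e = {a, b}" using two_coloring_cases[OF A(2)] by metis
        then have "a \<in> insert t A" "b \<notin> insert t A" using False by auto
        then show ?thesis using ab(3) by blast
      qed
    qed
    then show "\<exists>A. finite A \<and> two_coloring E A \<and> t \<in> A \<and> card A = Suc k" using A t
      by (intro exI[of _ "insert t A"]) auto
  qed
qed

section \<open>A unique triangle in a well-edge-dominated graph\<close>

definition outer :: "'a set set \<Rightarrow> 'a set \<Rightarrow> 'a \<Rightarrow> 'a set" where
  "outer E S t = {v. v \<notin> S \<and> {t, v} \<in> E}"

lemma matching_removed:
  assumes "matching M" "R \<subseteq> M" "r \<in> R" "v \<in> r"
  shows "v \<notin> \<Union>(M - R)"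
proof
  assume "v \<in> \<Union>(M - R)"
  then obtain m where m: "m \<in> M" "m \<notin> R" "v \<in> m" by auto
  then have "m = r" using matching_eq[OF assms(1) m(1) _ m(3) assms(4)] assms(2,3) by auto
  then show False using m assms(3) by simp
qed

text \<open>\<open>S\<close> is a parameter of its own so that permuted instances share it
  literally, and with it \<open>outer E S\<close> and \<open>del E S\<close>; facts then transfer
  between the roles of \<open>x\<close>, \<open>y\<close>, \<open>z\<close> without
  rewriting.\<close>

locale triangle_wed =
  fixes E :: "'a set set" and k :: nat and S :: "'a set" and x y z :: 'a
  assumes E: "edge_set E" and W: "well_dominated E k" and S: "S = {x, y, z}"
    and T: "{x, y} \<in> E" "{x, z} \<in> E" "{y, z} \<in> E"
    and uniq: "\<And>a b c. {a, b} \<in> E \<Longrightarrow> {b, c} \<in> E \<Longrightarrow> {a, c} \<in> E \<Longrightarrow> {a, b, c} = S"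
    and outer_ne: "\<And>t. t \<in> S \<Longrightarrow> outer E S t \<noteq> {}"
begin

abbreviation N where "N \<equiv> outer E S"
abbreviation H where "H \<equiv> del E S"

lemma xyz: "x \<noteq> y" "x \<noteq> z" "y \<noteq> z" "x \<in> S" "y \<in> S" "z \<in> S"
  using edge_neq[OF E T(1)] edge_neq[OF E T(2)] edge_neq[OF E T(3)] S by auto

text \<open>Together with the rotation \<open>perm_zxy\<close>, this transposition generates all
  relabelings of the triangle.\<close>

lemma perm_yxz: "triangle_wed E k S y x z"
proof
  show "edge_set E" "well_dominated E k" using E W by auto
  show "S = {y, x, z}" using S by auto
  show "{y, x} \<in> E" "{y, z} \<in> E" "{x, z} \<in> E" using T by (simp_all add: insert_commute)
  show "{a, b, c} = S" if "{a, b} \<in> E" "{b, c} \<in> E" "{a, c} \<in> E" for a b c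
    using uniq[OF that] .
  show "outer E S t \<noteq> {}" if "t \<in> S" for t using outer_ne[OF that] .
qed

lemma perm_zxy: "triangle_wed E k S z x y"
proof
  show "edge_set E" "well_dominated E k" using E W by auto
  show "S = {z, x, y}" using S by auto
  show "{z, x} \<in> E" "{z, y} \<in> E" "{x, y} \<in> E" using T by (simp_all add: insert_commute)
  show "{a, b, c} = S" if "{a, b} \<in> E" "{b, c} \<in> E" "{a, c} \<in> E" for a b c
    using uniq[OF that] .
  show "outer E S t \<noteq> {}" if "t \<in> S" for t using outer_ne[OF that] .
qed

lemma EH: "edge_set H"
  using edge_set_del[OF E] .

lemma N_notin: "v \<in> N t \<Longrightarrow> v \<notin> S" and N_edge: "v \<in> N t \<Longrightarrow> {t, v} \<in> E"
  unfolding outer_def by auto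

lemma H_notin: "e \<in> H \<Longrightarrow> v \<in> e \<Longrightarrow> v \<notin> S"
  using delD(2)[of e E S] by auto

lemma tri_edge: "s \<in> S \<Longrightarrow> t \<in> S \<Longrightarrow> s \<noteq> t \<Longrightarrow> {s, t} \<in> E"
  using T S by (auto simp: insert_commute)

lemma N_disjoint:
  assumes "v \<in> N s" "v \<in> N t" "s \<in> S" "t \<in> S"
  shows "s = t"
proof (rule ccontr)
  assume "s \<noteq> t"
  then have "{s, t, v} = S"
    using uniq[of s t v] tri_edge N_edge assms by simp
  then show False using N_notin[OF assms(1)] by auto
qed

lemma E_cases:
  assumes e: "e \<in> E"
  obtains "e \<in> H" | s t where "s \<in> S" "t \<in> S" "s \<noteq> t" "e = {s, t}"
    | t v where "t \<in> S" "v \<in> N t" "e = {t, v}"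
proof (cases "e \<inter> S = {}")
  case True
  then show thesis using that(1) delI[OF e] by simp
next
  case False
  then obtain t where t: "t \<in> e" "t \<in> S" by auto
  obtain v where v: "e = {t, v}" "t \<noteq> v" using edge_at[OF E e t(1)] .
  show thesis
  proof (cases "v \<in> S")
    case True
    then show thesis using that(2) t v by simp
  next
    case False
    then have "v \<in> N t" using e v unfolding outer_def by simp
    then show thesis using that(3) t v by simp
  qed
qed

text \<open>Edges of \<open>E\<close> outside \<open>H\<close> are triangle edges, met because of
  \<open>two\<close>, or edges to outer neighbors, met because of \<open>out\<close>. Two
  completions \<open>D\<close> of the same \<open>M\<close> must therefore have equally many
  edges.\<close>

lemma extend_card:
  assumes M: "maximal_matching H M" and D: "D \<subseteq> E" "matching D" "\<Union>D \<inter> \<Union>M = {}"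
    and out: "\<And>t. t \<in> S \<Longrightarrow> t \<notin> \<Union>D \<Longrightarrow> N t \<subseteq> \<Union>M \<union> \<Union>D"
    and two: "\<And>s t. s \<in> S \<Longrightarrow> t \<in> S \<Longrightarrow> s \<noteq> t \<Longrightarrow> s \<in> \<Union>D \<or> t \<in> \<Union>D"
  shows "card M + card D = k"
proof -
  have ME: "M \<subseteq> E" using maximal_matchingD(1)[OF M] del_subset[of E S] by simp
  have "maximal_matching E (M \<union> D)"
  proof (rule maximal_matchingI)
    show "matching (M \<union> D)"
    proof (rule matching_Un[OF maximal_matchingD(2)[OF M] D(2)])
      show "f \<inter> \<Union>M = {}" if "f \<in> D" for f using D(3) that by auto
    qed
    show "M \<union> D \<subseteq> E" using ME D by simp
    show "e \<inter> \<Union>(M \<union> D) \<noteq> {}" if "e \<in> E" for e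
      using that
    proof (cases rule: E_cases)
      case 1
      then show ?thesis using maximal_matchingD(3)[OF M] by auto
    next
      case (2 s t)
      then show ?thesis using two[of s t] by auto
    next
      case (3 t v)
      have "t \<in> \<Union>D \<or> v \<in> \<Union>M \<union> \<Union>D" using subsetD[OF out[OF 3(1)] 3(2)] by blast
      then show ?thesis using 3(3) by auto
    qed
  qed
  then have "card (M \<union> D) = k" using well_dominated_equimatchable[OF W] unfolding equimatchable_def by simp
  moreover have "M \<inter> D = {}"
  proof -
    have "m \<notin> D" if "m \<in> M" for m
      using that D(3) edge_setD(1)[OF E, of m] ME by auto
    then show ?thesis by auto
  qed
  ultimately show ?thesis
    using card_Un_disjoint[of M D] finite_edges[OF E] ME D by simp
qed

lemma matching2: "a \<noteq> c \<Longrightarrow> a \<noteq> d \<Longrightarrow> b \<noteq> c \<Longrightarrow> b \<noteq> d \<Longrightarrow> matching {{a, b}, {c, d}}"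
  unfolding matching_def by auto

lemma H_subset: "M \<subseteq> H \<Longrightarrow> s \<in> S \<Longrightarrow> s \<notin> \<Union>M"
  using H_notin by auto

text \<open>A missed neighbor would make \<open>E - \<Union>M\<close> a triangle with pendant edges, which is never
  equimatchable.\<close>

lemma cover_x:
  assumes M: "maximal_matching H M"
  shows "N x \<subseteq> \<Union>M"
proof (rule subsetI, rule ccontr)
  fix a assume a: "a \<in> N x" "a \<notin> \<Union>M"
  have aS: "a \<noteq> x" "a \<noteq> y" "a \<noteq> z" using N_notin[OF a(1)] S by auto
  have SM: "x \<notin> \<Union>M" "y \<notin> \<Union>M" "z \<notin> \<Union>M"
    using H_subset[OF maximal_matchingD(1)[OF M]] xyz by auto
  \<comment> \<open>A single triangle edge completes \<open>M\<close> if the third triangle vertex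
    has no missed neighbor.\<close>
  have one: "card M + 1 = k" if "s \<in> S" "t \<in> S" "s \<noteq> t" "\<And>r. r \<in> S \<Longrightarrow> r \<noteq> s \<Longrightarrow> r \<noteq> t \<Longrightarrow> N r \<subseteq> \<Union>M" for s t
  proof -
    have "card M + card {{s, t}} = k"
    proof (rule extend_card[OF M])
      show "{{s, t}} \<subseteq> E" using tri_edge that by simp
      show "matching {{s, t}}" unfolding matching_def by simp
      show "\<Union>{{s, t}} \<inter> \<Union>M = {}" using that SM S by auto
      show "N r \<subseteq> \<Union>M \<union> \<Union>{{s, t}}" if "r \<in> S" "r \<notin> \<Union>{{s, t}}" for r
        using that \<open>\<And>r. r \<in> S \<Longrightarrow> r \<noteq> s \<Longrightarrow> r \<noteq> t \<Longrightarrow> N r \<subseteq> \<Union>M\<close>[of r] by auto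
      show "p \<in> \<Union>{{s, t}} \<or> q \<in> \<Union>{{s, t}}" if "p \<in> S" "q \<in> S" "p \<noteq> q" for p q
        using that \<open>s \<in> S\<close> \<open>t \<in> S\<close> \<open>s \<noteq> t\<close> unfolding S by auto
    qed
    then show ?thesis by simp
  qed
  have two: "card M + 2 = k"
    if t: "t \<in> S" "t \<noteq> x" "b \<in> N t" "b \<notin> \<Union>M" and r: "\<And>r. r \<in> S \<Longrightarrow> r \<noteq> x \<Longrightarrow> r \<noteq> t \<Longrightarrow> N r \<subseteq> \<Union>M" for t b
  proof -
    have b: "b \<notin> S" "b \<noteq> a" using N_notin[OF t(3)] N_disjoint[OF a(1), of t] t xyz by auto
    have ne: "{x, a} \<noteq> {t, b}" using t b aS S by auto
    have "card M + card {{x, a}, {t, b}} = k"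
    proof (rule extend_card[OF M])
      show "{{x, a}, {t, b}} \<subseteq> E" using N_edge a t by simp
      show "matching {{x, a}, {t, b}}"
        by (rule matching2) (use t b aS xyz S in auto)
      show "\<Union>{{x, a}, {t, b}} \<inter> \<Union>M = {}" using t a SM S by auto
      show "N r \<subseteq> \<Union>M \<union> \<Union>{{x, a}, {t, b}}" if "r \<in> S" "r \<notin> \<Union>{{x, a}, {t, b}}" for r
        using that r[of r] by auto
      show "p \<in> \<Union>{{x, a}, {t, b}} \<or> q \<in> \<Union>{{x, a}, {t, b}}" if "p \<in> S" "q \<in> S" "p \<noteq> q" for p q
        using that t(1,2) unfolding S by auto
    qed
    then show ?thesis using ne by simp
  qed
  \<comment> \<open>The cases list which of \<open>y\<close>, \<open>z\<close> also have a missed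
    neighbor. Each admits completions of two sizes: one and two edges, or two and three when all
    three triangle vertices have one.\<close>
  consider "N y \<subseteq> \<Union>M" "N z \<subseteq> \<Union>M" | b where "b \<in> N y" "b \<notin> \<Union>M" "N z \<subseteq> \<Union>M"
    | c where "N y \<subseteq> \<Union>M" "c \<in> N z" "c \<notin> \<Union>M"
    | b c where "b \<in> N y" "b \<notin> \<Union>M" "c \<in> N z" "c \<notin> \<Union>M" by blast
  then show False
  proof cases
    case 1
    have 1: "card M + 1 = k" using one[of x y] 1 xyz S by auto
    have ne: "{x, a} \<noteq> {y, z}" using aS xyz by auto
    have "card M + card {{x, a}, {y, z}} = k"
    proof (rule extend_card[OF M])
      show "{{x, a}, {y, z}} \<subseteq> E" using N_edge a T by simp
      show "matching {{x, a}, {y, z}}"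
        by (rule matching2) (use aS xyz in auto)
      show "\<Union>{{x, a}, {y, z}} \<inter> \<Union>M = {}" using a SM by auto
      show "N r \<subseteq> \<Union>M \<union> \<Union>{{x, a}, {y, z}}" if "r \<in> S" "r \<notin> \<Union>{{x, a}, {y, z}}" for r
        using that S by auto
      show "p \<in> \<Union>{{x, a}, {y, z}} \<or> q \<in> \<Union>{{x, a}, {y, z}}" if "p \<in> S" "q \<in> S" "p \<noteq> q" for p q
        using that unfolding S by auto
    qed
    then show ?thesis using ne 1 by simp
  next
    case 2
    have "card M + 1 = k" using one[of x y] 2 xyz S by auto
    moreover have "card M + 2 = k" using two[of y b] 2 xyz S by auto
    ultimately show ?thesis by simp
  next
    case 3
    have "card M + 1 = k" using one[of x z] 3 xyz S by auto
    moreover have "card M + 2 = k" using two[of z c] 3 xyz S by auto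
    ultimately show ?thesis by simp
  next
    case 4
    have b: "b \<notin> S" "b \<noteq> a" "c \<notin> S" "c \<noteq> a" "b \<noteq> c"
      using 4 N_notin[of b y] N_notin[of c z] N_disjoint[OF a(1), of y] N_disjoint[OF a(1), of z]
        N_disjoint[of b y z] xyz by auto
    then have b': "b \<noteq> x" "b \<noteq> y" "b \<noteq> z" "c \<noteq> x" "c \<noteq> y" "c \<noteq> z" using S by auto
    have "{x, y} \<noteq> {z, c}" using b' xyz by auto
    moreover have "card M + card {{x, y}, {z, c}} = k"
    proof (rule extend_card[OF M])
      show "{{x, y}, {z, c}} \<subseteq> E" using N_edge 4 T by simp
      show "matching {{x, y}, {z, c}}"
        by (rule matching2) (use b' xyz in auto)
      show "\<Union>{{x, y}, {z, c}} \<inter> \<Union>M = {}" using 4 SM by auto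
    qed (use S in auto)
    moreover have "card M + card {{x, a}, {y, b}, {z, c}} = k"
    proof (rule extend_card[OF M])
      show "{{x, a}, {y, b}, {z, c}} \<subseteq> E" using N_edge a 4 by simp
      show "matching {{x, a}, {y, b}, {z, c}}"
        using aS xyz b b' unfolding matching_def by auto
      show "\<Union>{{x, a}, {y, b}, {z, c}} \<inter> \<Union>M = {}" using 4 a SM by auto
    qed (use S in auto)
    moreover have "card {{x, a}, {y, b}, {z, c}} = 3"
    proof -
      have "{x, a} \<noteq> {y, b}" "{x, a} \<noteq> {z, c}" "{y, b} \<noteq> {z, c}" using aS xyz b b' by auto
      then show ?thesis by simp
    qed
    ultimately show ?thesis by simp
  qed
qed

lemma cover:
  assumes M: "maximal_matching H M" and "t \<in> S" "v \<in> N t"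
  shows "v \<in> \<Union>M"
  using cover_x[OF M] triangle_wed.cover_x[OF perm_yxz M] triangle_wed.cover_x[OF perm_zxy M]
    assms(2,3) S by auto

text \<open>By \<open>cover\<close>, the edge \<open>{x, y}\<close> alone completes
  \<open>M\<close>, since the outer neighbors of \<open>z\<close> are already covered.\<close>

lemma maximal_matching_H_card:
  assumes M: "maximal_matching H M"
  shows "Suc (card M) = k"
proof -
  have "card M + card {{x, y}} = k"
  proof (rule extend_card[OF M])
    show "\<Union>{{x, y}} \<inter> \<Union>M = {}" using H_subset[OF maximal_matchingD(1)[OF M]] xyz by auto
    show "N r \<subseteq> \<Union>M \<union> \<Union>{{x, y}}" if "r \<in> S" for r using cover[OF M that] by auto
  qed (use T S in \<open>auto simp: matching_def\<close>)
  then show ?thesis by simp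
qed

lemma equimatchable_H: "equimatchable H (k - 1)"
  unfolding equimatchable_def using maximal_matching_H_card by fastforce

text \<open>Otherwise trading \<open>{c, c'}\<close> for \<open>{c', u}\<close> gives a maximal matching of \<open>H\<close> that misses \<open>c\<close>.\<close>

lemma no_swap:
  assumes M: "maximal_matching H M" and c: "{c, c'} \<in> M" "t \<in> S" "c \<in> N t" and u: "{c', u} \<in> H"
  shows "u \<in> \<Union>M"
proof (rule ccontr)
  assume uM: "u \<notin> \<Union>M"
  let ?R = "M - {{c, c'}}"
  have MH: "M \<subseteq> H" "matching M" using maximal_matchingD[OF M] by auto
  have ne: "c \<noteq> c'" "c' \<noteq> u" using edge_neq[OF EH] u c(1) MH(1) by auto
  have cR: "c \<notin> \<Union>?R" "c' \<notin> \<Union>?R" "u \<notin> \<Union>?R"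
    using matching_eq[OF MH(2), of "{c, c'}"] c(1) uM by auto
  have uc: "u \<noteq> c" using uM c(1) by auto
  have "{c', u} \<inter> \<Union>?R = {}" using cR by auto
  then have m: "matching (insert {c', u} ?R)"
    by (intro matching_insert matching_subset[OF MH(2)]) simp_all
  have "{c', u} \<notin> ?R" using cR by auto
  moreover have "finite M" using finite_edges[OF EH MH(1)] .
  ultimately have "card (insert {c', u} ?R) = Suc (card ?R)" by simp
  also have "\<dots> = card M" using card_Suc_Diff1[OF \<open>finite M\<close> c(1)] .
  finally have "card (insert {c', u} ?R) = k - 1" using maximal_matching_H_card[OF M] by simp
  moreover have "insert {c', u} ?R \<subseteq> H" using MH(1) u by auto
  ultimately have "maximal_matching H (insert {c', u} ?R)" using equimatchable_maximal_matching[OF EH equimatchable_H] m by simp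
  then have "c \<in> \<Union>(insert {c', u} ?R)" using cover c by metis
  then show False using cR(1) ne uc by auto
qed

text \<open>Used with \<open>M'\<close> obtained from \<open>M\<close> by trading edges at neighbors
  of the triangle for as many edges into the triangle.\<close>

lemma exchange:
  assumes M: "maximal_matching H M" and M': "M' \<subseteq> E" "matching M'" "card M' = card M"
  obtains e where "e \<in> E" "e \<inter> \<Union>M' = {}"
proof -
  have "\<not> maximal_matching E M'"
    using maximal_matching_H_card[OF M] well_dominated_equimatchable[OF W] M'(3) unfolding equimatchable_def by auto
  then show thesis using maximal_matchingI[OF M'(1,2)] that by blast
qed

abbreviation reach where "reach a b \<equiv> (a, b) \<in> (adj H)\<^sup>*"

lemma reach_edge: "{a, b} \<in> H \<Longrightarrow> reach a b"
  by (simp add: adj_iff r_into_rtrancl)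

lemma mate:
  assumes "maximal_matching H M" "t \<in> S" "c \<in> N t"
  obtains c' where "{c, c'} \<in> M" "{c, c'} \<in> H" "reach c c'"
proof -
  obtain e where e: "e \<in> M" "c \<in> e" using cover[OF assms] by auto
  have eH: "e \<in> H" using e(1) maximal_matchingD(1)[OF assms(1)] by auto
  obtain c' where "e = {c, c'}" using edge_at[OF EH eH e(2)] .
  then show thesis using that e eH reach_edge by simp
qed

text \<open>Trade the matching edges at \<open>c\<close>, \<open>d\<close>, \<open>e\<close> for
  \<open>{x, c}\<close>, \<open>{y, d}\<close>, \<open>{z, e}\<close>. The edge missed afterwards
  lies in \<open>H\<close> and meets \<open>M\<close> at one of the abandoned mates
  \<open>c'\<close>, \<open>d'\<close>, \<open>e'\<close>; by \<open>no_swap\<close> its other end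
  is such a mate too. It would join two of the three components.\<close>

lemma no_three:
  assumes c: "c \<in> N x" "d \<in> N y" "e \<in> N z"
    and nr: "\<not> reach c d" "\<not> reach c e" "\<not> reach d e"
  shows False
proof -
  obtain M where M: "maximal_matching H M" using maximal_matching_exists[OF EH] .
  have MH: "M \<subseteq> H" "matching M" using maximal_matchingD[OF M] by auto
  obtain c' where c': "{c, c'} \<in> M" "{c, c'} \<in> H" "reach c c'" using mate[OF M xyz(4) c(1)] .
  obtain d' where d': "{d, d'} \<in> M" "{d, d'} \<in> H" "reach d d'" using mate[OF M xyz(5) c(2)] .
  obtain e' where e': "{e, e'} \<in> M" "{e, e'} \<in> H" "reach e e'" using mate[OF M xyz(6) c(3)] .
  let ?R = "{{c, c'}, {d, d'}, {e, e'}}" and ?D = "{{x, c}, {y, d}, {z, e}}"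
  define Q where "Q = M - ?R"
  define B where "B = \<Union>Q"
  let ?M = "Q \<union> ?D"
  have nS: "c \<notin> S" "d \<notin> S" "e \<notin> S" using c N_notin by auto
  have ne: "c \<noteq> d" "c \<noteq> e" "d \<noteq> e" using nr by auto
  have ne': "c \<noteq> d'" "c \<noteq> e'" "d \<noteq> c'" "d \<noteq> e'" "e \<noteq> c'" "e \<noteq> d'"
    using nr reach_sym[OF d'(3)] reach_sym[OF e'(3)] c'(3) d'(3) by auto
  have "{c, c'} \<noteq> {d, d'}" "{c, c'} \<noteq> {e, e'}" "{d, d'} \<noteq> {e, e'}" using ne ne' by auto
  then have cR: "card ?R = 3" by simp
  have nS': "c \<noteq> x" "c \<noteq> y" "c \<noteq> z" "d \<noteq> x" "d \<noteq> y" "d \<noteq> z" "e \<noteq> x" "e \<noteq> y" "e \<noteq> z"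
    using nS S by auto
  have "{x, c} \<noteq> {y, d}" "{x, c} \<noteq> {z, e}" "{y, d} \<noteq> {z, e}" using nS' ne xyz by auto
  then have cD: "card ?D = 3" by simp
  have RM: "?R \<subseteq> M" using c' d' e' by simp
  have cde: "c \<notin> B" "d \<notin> B" "e \<notin> B"
    using matching_removed[OF MH(2) RM, of "{c, c'}" c] matching_removed[OF MH(2) RM, of "{d, d'}" d]
      matching_removed[OF MH(2) RM, of "{e, e'}" e]
    unfolding B_def Q_def by simp_all
  have SR: "x \<notin> B" "y \<notin> B" "z \<notin> B"
    using H_subset[OF MH(1)] xyz unfolding B_def Q_def by auto
  have fin: "finite M" using finite_edges[OF EH MH(1)] .
  have "?M \<subseteq> E" using MH(1) del_subset[of E S] N_edge Q_def c by auto
  moreover have "matching ?M"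
  proof (rule matching_Un)
    show "matching Q" using matching_subset[OF MH(2)] unfolding Q_def by auto
    have "matching {{y, d}, {z, e}}" by (rule matching2) (use nS' ne xyz in auto)
    moreover have "{x, c} \<inter> \<Union>{{y, d}, {z, e}} = {}" using nS' ne xyz by auto
    ultimately show "matching ?D" by (rule matching_insert)
    have "{x, c} \<inter> B = {}" "{y, d} \<inter> B = {}" "{z, e} \<inter> B = {}"
      using cde SR by simp_all
    then show "f \<inter> \<Union>Q = {}" if f: "f \<in> ?D" for f using f unfolding B_def[symmetric] by blast
  qed
  moreover have "card ?M = card M"
  proof -
    have "Q \<inter> ?D = {}" using SR unfolding B_def by auto
    then have "card ?M = card Q + 3" 
      using card_Un_disjoint[of Q ?D] fin cD unfolding Q_def by simp
    moreover have "card Q = card M - 3" using card_Diff_subset[OF _ RM] cR unfolding Q_def by simp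
    moreover have "3 \<le> card M" using card_mono[OF fin RM] cR unfolding Q_def by simp
    ultimately show ?thesis by linarith
  qed
  ultimately obtain f where f: "f \<in> E" "f \<inter> \<Union>?M = {}" by (rule exchange[OF M])
  have fD: "x \<notin> f" "y \<notin> f" "z \<notin> f" "c \<notin> f" "d \<notin> f" "e \<notin> f" using f(2) by simp_all
  then have fH: "f \<in> H" using delI[OF f(1), of S] S by auto
  have old: "v \<in> {c', d', e'}" if v: "v \<in> f" "v \<in> \<Union>M" for v
  proof -
    obtain m where m: "m \<in> M" "v \<in> m" using v by auto
    have "m \<in> ?R"
    proof (rule ccontr)
      assume "m \<notin> ?R"
      then have "m \<in> Q" using m(1) unfolding Q_def by (rule DiffI[rotated])
      then have "v \<in> \<Union>?M" using m(2) by (intro UnionI UnI1)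
      then have "v \<in> f \<inter> \<Union>?M" by (rule IntI[OF v(1)])
      then show False by (simp only: f(2) empty_iff)
    qed
    then show ?thesis using m fD v by auto
  qed
  obtain p where p: "p \<in> f" "p \<in> \<Union>M" using maximal_matchingD(3)[OF M fH] by auto
  obtain q where q: "f = {p, q}" "p \<noteq> q" using edge_at[OF EH fH p(1)] .
  have pq: "{p, q} \<in> H" using fH q by simp
  have "q \<in> \<Union>M"
    using old[OF p] no_swap[OF M c'(1) xyz(4) c(1)] no_swap[OF M d'(1) xyz(5) c(2)]
      no_swap[OF M e'(1) xyz(6) c(3)] pq by auto
  then have "q \<in> {c', d', e'}" "p \<in> {c', d', e'}" using old q(1) p by auto
  moreover have "reach p q" "reach q p" using reach_edge[OF pq] reach_sym by auto
  ultimately have "reach c' d' \<or> reach c' e' \<or> reach d' e'" using q(2) reach_sym by auto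
  then show False
    using nr c'(3) reach_sym[OF d'(3)] reach_sym[OF e'(3)] d'(3) by (meson rtrancl_trans)
qed

text \<open>Trade \<open>{c, c'}\<close> and the matching edge at \<open>d\<close> for
  \<open>{x, c}\<close> and \<open>{z, d}\<close>. As in \<open>no_three\<close>, the missed edge
  cannot lie in \<open>H\<close>, so it joins \<open>y\<close> to a neighbor that \<open>M\<close>
  covers, which is \<open>c'\<close> or \<open>d'\<close>. The component of \<open>d\<close>
  contains no neighbor of \<open>y\<close>, which leaves \<open>c'\<close>.\<close>

lemma crossing:
  assumes c: "c \<in> N x" "{c, c'} \<in> H" and d: "d \<in> N z"
    and nr: "\<not> reach c d" and dN: "\<And>w. reach d w \<Longrightarrow> w \<notin> N y"
  shows "c' \<in> N y"
proof -
  have "matching {{c, c'}}" unfolding matching_def by simp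
  then obtain M where c'M: "{{c, c'}} \<subseteq> M" and M: "maximal_matching H M"
    using maximal_matching_extend[OF EH, of "{{c, c'}}"] c by auto
  have c': "{c, c'} \<in> M" "reach c c'" using c'M reach_edge[OF c(2)] by auto
  have MH: "M \<subseteq> H" "matching M" using maximal_matchingD[OF M] by auto
  obtain d' where d': "{d, d'} \<in> M" "{d, d'} \<in> H" "reach d d'" using mate[OF M xyz(6) d] .
  let ?R = "{{c, c'}, {d, d'}}" and ?D = "{{x, c}, {z, d}}"
  define Q where "Q = M - ?R"
  define B where "B = \<Union>Q"
  let ?M = "Q \<union> ?D"
  have nS: "c \<notin> S" "d \<notin> S" using c d N_notin by auto
  have ne: "c \<noteq> d" using nr by auto
  have ne': "c \<noteq> d'" using nr reach_sym[OF d'(3)] by auto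
  have "{c, c'} \<noteq> {d, d'}" using ne ne' by auto
  then have cR: "card ?R = 2" by simp
  have nS': "c \<noteq> x" "c \<noteq> y" "c \<noteq> z" "d \<noteq> x" "d \<noteq> y" "d \<noteq> z"
    using nS S by auto
  have "{x, c} \<noteq> {z, d}" using nS' ne xyz by auto
  then have cD: "card ?D = 2" by simp
  have RM: "?R \<subseteq> M" using c' d' by simp
  have cd: "c \<notin> B" "d \<notin> B"
    using matching_removed[OF MH(2) RM, of "{c, c'}" c] matching_removed[OF MH(2) RM, of "{d, d'}" d]
    unfolding B_def Q_def by simp_all
  have SR: "x \<notin> B" "y \<notin> B" "z \<notin> B"
    using H_subset[OF MH(1)] xyz unfolding B_def Q_def by auto
  have fin: "finite M" using finite_edges[OF EH MH(1)] .
  have "?M \<subseteq> E" using MH(1) del_subset[of E S] N_edge Q_def c d by auto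
  moreover have "matching ?M"
  proof (rule matching_Un)
    show "matching Q" using matching_subset[OF MH(2)] unfolding Q_def by auto
    show "matching ?D" by (rule matching2) (use nS' ne xyz in auto)
    have "{x, c} \<inter> B = {}" "{z, d} \<inter> B = {}"
      using cd SR by simp_all
    then show "f \<inter> \<Union>Q = {}" if f: "f \<in> ?D" for f using f unfolding B_def[symmetric] by blast
  qed
  moreover have "card ?M = card M"
  proof -
    have "Q \<inter> ?D = {}" using SR unfolding B_def by auto
    then have "card ?M = card Q + 2" 
      using card_Un_disjoint[of Q ?D] fin cD unfolding Q_def by simp
    moreover have "card Q = card M - 2" using card_Diff_subset[OF _ RM] cR unfolding Q_def by simp
    moreover have "2 \<le> card M" using card_mono[OF fin RM] cR unfolding Q_def by simp
    ultimately show ?thesis by linarith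
  qed
  ultimately obtain f where f: "f \<in> E" "f \<inter> \<Union>?M = {}" by (rule exchange[OF M])
  have fD: "x \<notin> f" "z \<notin> f" "c \<notin> f" "d \<notin> f" using f(2) by simp_all
  have old: "v \<in> {c', d'}" if v: "v \<in> f" "v \<in> \<Union>M" for v
  proof -
    obtain m where m: "m \<in> M" "v \<in> m" using v by auto
    have "m \<in> ?R"
    proof (rule ccontr)
      assume "m \<notin> ?R"
      then have "m \<in> Q" using m(1) unfolding Q_def by (rule DiffI[rotated])
      then have "v \<in> \<Union>?M" using m(2) by (intro UnionI UnI1)
      then have "v \<in> f \<inter> \<Union>?M" by (rule IntI[OF v(1)])
      then show False by (simp only: f(2) empty_iff)
    qed
    then show ?thesis using m fD v by auto
  qed
  show ?thesis
    using f(1)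
  proof (cases rule: E_cases)
    case 1
    obtain p where p: "p \<in> f" "p \<in> \<Union>M" using maximal_matchingD(3)[OF M 1] by auto
    obtain q where q: "f = {p, q}" "p \<noteq> q" using edge_at[OF EH 1 p(1)] .
    have pq: "{p, q} \<in> H" using 1 q by simp
    have "q \<in> \<Union>M"
      using old[OF p] no_swap[OF M c'(1) xyz(4) c(1)] no_swap[OF M d'(1) xyz(6) d] pq by auto
    then have "q \<in> {c', d'}" "p \<in> {c', d'}" using old q(1) p by auto
    moreover have "reach p q" "reach q p" using reach_edge[OF pq] reach_sym by auto
    ultimately have "reach c' d'" using q(2) by auto
    then show ?thesis
      using nr c'(2) reach_sym[OF d'(3)] by (meson rtrancl_trans)
  next
    case (2 s t)
    then show ?thesis using fD S by auto
  next
    case (3 t v)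
    then have "t = y" using fD S by auto
    then have "v \<in> N y" "v \<in> \<Union>M" using 3 cover[OF M] by auto
    then show ?thesis using old[of v] 3(3) dN[OF d'(3)] by auto
  qed
qed

end

section \<open>Three sets without distinct representatives\<close>

lemma three_sets_aux:
  assumes ne: "Y \<noteq> {}" and neZ: "Z \<noteq> {}"
    and sdr: "\<And>a b c. a \<in> X \<Longrightarrow> b \<in> Y \<Longrightarrow> c \<in> Z \<Longrightarrow> a = b \<or> a = c \<or> b = c"
    and c: "c \<in> X" "c \<notin> Z" and a: "a \<in> Y \<union> Z" "a \<notin> X" and b: "b \<in> X \<union> Z" "b \<notin> Y"
  shows "X = {c} \<and> Y = {c} \<or> Y = {a} \<and> Z = {a}"
proof (cases "a \<in> Y")
  case True
  have Z: "v = a" if "v \<in> Z" for v using sdr[OF c(1) True that] that c a(2) by metis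
  have bX: "b \<in> X" using Z b True by blast
  have "a \<in> Z" using Z neZ by blast
  have Y: "v = a" if "v \<in> Y" for v using sdr[OF bX that \<open>a \<in> Z\<close>] that b(2) True by metis
  have "Y = {a}" using Y True by blast
  moreover have "Z = {a}" using Z \<open>a \<in> Z\<close> by blast
  ultimately show ?thesis by simp
next
  case False
  then have aZ: "a \<in> Z" using a by simp
  have Y: "v = c" if "v \<in> Y" for v using sdr[OF c(1) that aZ] that False c(2) aZ by metis
  have "c \<in> Y" using Y ne by blast
  have X: "v = c" if "v \<in> X" for v using sdr[OF that \<open>c \<in> Y\<close> aZ] that a(2) c aZ by metis
  have "X = {c}" using X c(1) by blast
  moreover have "Y = {c}" using Y \<open>c \<in> Y\<close> by blast
  ultimately show ?thesis by simp
qed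

text \<open>Applied to the sets of components seen by the triangle vertices, where
  \<open>no_three\<close> rules out distinct representatives. Distinct representatives of two of the
  sets, one of them absent from the third set, force the third to be a singleton; doing this twice
  yields two equal singletons.\<close>

lemma three_sets:
  assumes ne: "X \<noteq> {}" "Y \<noteq> {}" "Z \<noteq> {}"
    and sdr: "\<And>a b c. a \<in> X \<Longrightarrow> b \<in> Y \<Longrightarrow> c \<in> Z \<Longrightarrow> a = b \<or> a = c \<or> b = c"
    and out: "\<exists>c\<in>X \<union> Y. c \<notin> Z" "\<exists>a\<in>Y \<union> Z. a \<notin> X" "\<exists>b\<in>X \<union> Z. b \<notin> Y"
  shows "\<exists>C. X = {C} \<and> Y = {C} \<and> C \<notin> Z \<or> X = {C} \<and> Z = {C} \<and> C \<notin> Y \<or> Y = {C} \<and> Z = {C} \<and> C \<notin> X"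
proof -
  obtain a b c where a: "a \<in> Y \<union> Z" "a \<notin> X" and b: "b \<in> X \<union> Z" "b \<notin> Y"
    and c: "c \<in> X \<union> Y" "c \<notin> Z" using out by blast
  show ?thesis
  proof (cases "c \<in> X")
    case True
    then show ?thesis using three_sets_aux[OF ne(2,3) sdr True c(2) a b] a b c by auto
  next
    case False
    then have "c \<in> Y" using c by simp
    have "d = e \<or> d = f \<or> e = f" if "d \<in> Y" "e \<in> X" "f \<in> Z" for d e f
      using sdr[OF that(2,1,3)] by auto
    from three_sets_aux[OF ne(1,3) this \<open>c \<in> Y\<close> c(2) b a] show ?thesis using a b c by auto
  qed
qed

section \<open>Minimal edge dominating sets that miss a vertex\<close>

definition star :: "'a set set \<Rightarrow> 'a \<Rightarrow> 'a set" where
  "star K v = {w. {v, w} \<in> K}"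

text \<open>If every neighbor \<open>w\<close> of \<open>v\<close> has a further neighbor \<open>c w\<close>, these edges cover the neighborhood of
  \<open>v\<close> but not \<open>v\<close>, so that \<open>{v, w}\<close> is a private edge of \<open>{w, c w}\<close>.\<close>

definition star_cover :: "'a set set \<Rightarrow> 'a \<Rightarrow> ('a \<Rightarrow> 'a) \<Rightarrow> 'a set set" where
  "star_cover K v c = (\<lambda>w. {w, c w}) ` star K v"

text \<open>A maximal matching of what the star cover leaves untouched dominates the remaining edges
  without reaching \<open>v\<close>. As \<open>c w\<close> is no neighbor of \<open>v\<close>, each
  \<open>w\<close> lies on no cover edge but its own, so \<open>{v, w}\<close> is private to it. The
  private edges are exported because they must survive further additions.\<close>

lemma star_cover_min_edge_dom:
  assumes K: "edge_set K"
    and cc: "\<forall>w\<in>star K v. {w, c w} \<in> K \<and> c w \<noteq> v \<and> c w \<notin> star K v"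
    and M: "maximal_matching (del K (insert v (\<Union>(star_cover K v c)))) M"
  defines "X \<equiv> star_cover K v c \<union> M"
  shows "X \<subseteq> K" "v \<notin> \<Union>X" "e \<in> K \<Longrightarrow> e \<inter> \<Union>X \<noteq> {}"
    and "w \<in> star K v \<Longrightarrow> {v, w} \<inter> \<Union>(X - {{w, c w}}) = {}"
    and "m \<in> M \<Longrightarrow> m \<inter> \<Union>(X - {m}) = {}"
    and "m \<in> M \<Longrightarrow> m \<inter> \<Union>(star_cover K v c) = {}"
    and "min_edge_dom K X"
proof -
  let ?F = "star_cover K v c"
  note c = bspec[OF cc]
  have Md: "m \<in> K" "v \<notin> m" "m \<inter> \<Union>?F = {}" if "m \<in> M" for m
  proof -
    have "m \<in> del K (insert v (\<Union>?F))" using that maximal_matchingD(1)[OF M] by auto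
    from delD[OF this] show "m \<in> K" "v \<notin> m" "m \<inter> \<Union>?F = {}" by auto
  qed
  have Fw: "\<exists>w\<in>star K v. f = {w, c w}" if "f \<in> ?F" for f
    using that unfolding star_cover_def by auto
  have vs: "w \<noteq> v" if "w \<in> star K v" for w using edge_neq[OF K] that unfolding star_def by auto
  show XK: "X \<subseteq> K"
    using Md(1) c unfolding X_def star_cover_def by auto
  have vF: "v \<notin> f" if "f \<in> ?F" for f
    using Fw[OF that] vs c by auto
  show vX: "v \<notin> \<Union>X"
    using Md(2) vF unfolding X_def by auto
  show dom: "e \<inter> \<Union>X \<noteq> {}" if e: "e \<in> K" for e
  proof (cases "e \<inter> insert v (\<Union>?F) = {}")
    case True
    show ?thesis using maximal_matchingD(3)[OF M delI[OF e True]] unfolding X_def by auto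
  next
    case False
    show ?thesis
    proof (cases "v \<in> e")
      case True
      then obtain w where w: "e = {v, w}" using edge_at[OF K e] by metis
      then have "w \<in> star K v" using e unfolding star_def by simp
      then have "{w, c w} \<in> ?F" unfolding star_cover_def by simp
      then have "w \<in> \<Union>X" unfolding X_def by auto
      then show ?thesis using w by auto
    next
      case False
      then show ?thesis using \<open>e \<inter> insert v (\<Union>?F) \<noteq> {}\<close> unfolding X_def by auto
    qed
  qed
  show priv: "{v, w} \<inter> \<Union>(X - {{w, c w}}) = {}" if w: "w \<in> star K v" for w
  proof -
    have "w \<notin> f" if f: "f \<in> X" "f \<noteq> {w, c w}" for f
    proof (cases "f \<in> M")
      case True
      have "{w, c w} \<in> ?F" using w unfolding star_cover_def by simp
      then show ?thesis using Md(3)[OF True] by auto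
    next
      case False
      then obtain u where "u \<in> star K v" "f = {u, c u}" using Fw f unfolding X_def by auto
      then show ?thesis using c[of u] w f(2) by auto
    qed
    moreover have "v \<notin> \<Union>(X - {{w, c w}})" using vX by auto
    ultimately show ?thesis by auto
  qed
  show MF: "m \<inter> \<Union>?F = {}" if "m \<in> M" for m using Md(3)[OF that] .
  show privM: "m \<inter> \<Union>(X - {m}) = {}" if m: "m \<in> M" for m
  proof -
    have "m \<inter> f = {}" if f: "f \<in> X" "f \<noteq> m" for f
    proof (cases "f \<in> M")
      case True
      then show ?thesis using matchingD[OF maximal_matchingD(2)[OF M] m] f by auto
    next
      case False
      then have "f \<in> ?F" using f unfolding X_def by simp
      then show ?thesis using MF[OF m] by auto
    qed
    then show ?thesis by auto
  qed
  show "min_edge_dom K X"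
  proof (rule min_edge_domI[OF XK dom])
    fix e assume e: "e \<in> X"
    show "\<exists>p\<in>K. p \<inter> \<Union>(X - {e}) = {}"
    proof (cases "e \<in> M")
      case True
      show ?thesis using privM[OF True] Md(1)[OF True] by (rule bexI)
    next
      case False
      then obtain w where w: "w \<in> star K v" "e = {w, c w}" using Fw e unfolding X_def by auto
      have "{v, w} \<inter> \<Union>(X - {e}) = {}" using priv[OF w(1)] w(2) by simp
      moreover have "{v, w} \<in> K" using w(1) unfolding star_def by simp
      ultimately show ?thesis by (rule bexI)
    qed
  qed
qed

section \<open>The component attached to two triangle vertices\<close>

locale house_case = triangle_wed +
  assumes same: "\<And>c d. c \<in> N x \<union> N y \<Longrightarrow> d \<in> N x \<union> N y \<Longrightarrow> reach c d"
    and sep: "\<And>c d. c \<in> N x \<union> N y \<Longrightarrow> d \<in> N z \<Longrightarrow> \<not> reach c d"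
begin

lemma perm_house: "house_case E k S y x z"
  by (rule house_case.intro[OF perm_yxz], unfold_locales) (use same sep in auto)

text \<open>Any outer neighbor \<open>d\<close> of \<open>z\<close> supplies the second component
  required by \<open>crossing\<close>: by \<open>sep\<close> it contains no neighbor of
  \<open>y\<close>.\<close>

lemma cross:
  assumes c: "c \<in> N x" "{c, c'} \<in> H"
  shows "c' \<in> N y"
proof -
  obtain d where d: "d \<in> N z" using outer_ne[of z] xyz by auto
  have nr: "\<not> reach c d" using sep[of c d] c d by simp
  have "w \<notin> N y" if w: "reach d w" for w
  proof
    assume "w \<in> N y"
    then have "\<not> reach w d" using sep[of w d] d by simp
    then show False using reach_sym[OF w] by simp
  qed
  from crossing[OF c d nr this] show ?thesis .
qed

lemma cross':
  assumes "c \<in> N y" "{c, c'} \<in> H"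
  shows "c' \<in> N x"
  using house_case.cross[OF perm_house assms] .

text \<open>A star cover at \<open>a'\<close> gives a minimal edge dominating set \<open>X\<close>
  of \<open>H\<close> that covers \<open>a\<close> but misses \<open>a'\<close>. Adding
  \<open>{x, a}\<close> leaves it the private edge \<open>{x, a'}\<close> and spoils no private edge
  of \<open>X\<close>, as these can be chosen to avoid \<open>a\<close>. So \<open>X\<close> can be
  completed by one edge or by two.\<close>

lemma unique_neighbor:
  assumes a: "a \<in> N x" "a' \<in> N x" and b: "{a, b} \<in> H" "{b, a'} \<in> H"
  shows "a = a'"
proof (rule ccontr)
  assume aa': "a \<noteq> a'"
  let ?P = "star H a'"
  have PN: "w \<in> N y" if "w \<in> ?P" for w using cross[OF a(2)] that unfolding star_def by simp
  have bP: "b \<in> ?P" using b unfolding star_def by (simp add: insert_commute)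
  have xyd: "v \<notin> N y" if "v \<in> N x" for v using N_disjoint[OF that, of y] xyz by auto
  \<comment> \<open>For \<open>w\<close> other than \<open>b\<close>, a maximal matching containing
    \<open>{b, a'}\<close> must still cover \<open>w\<close>, which lies in \<open>N y\<close>, and
    its mate there is not \<open>a'\<close>.\<close>
  have other: "\<exists>c. {w, c} \<in> H \<and> c \<noteq> a'" if w: "w \<in> ?P" for w
  proof (cases "w = b")
    case True
    then show ?thesis using b(1) aa' by (intro exI[of _ a]) (simp add: insert_commute)
  next
    case False
    have "matching {{b, a'}}" unfolding matching_def by simp
    then obtain M where bM: "{{b, a'}} \<subseteq> M" and M: "maximal_matching H M"
      using maximal_matching_extend[OF EH, of "{{b, a'}}"] b(2) by auto
    obtain c where c: "{w, c} \<in> M" "{w, c} \<in> H" using mate[OF M xyz(5) PN[OF w]] by metis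
    have "c \<noteq> a'"
    proof
      assume "c = a'"
      then have "{w, a'} = {b, a'}"
        using matching_eq[OF maximal_matchingD(2)[OF M] c(1), of "{b, a'}" a'] bM by simp
      then show False using False by (auto simp: doubleton_eq_iff)
    qed
    then show ?thesis using c(2) by auto
  qed
  \<comment> \<open>Preferring \<open>a\<close> makes \<open>c b = a\<close>, which puts
    \<open>a\<close> into the star cover.\<close>
  define c where "c w = (if {w, a} \<in> H then a else SOME u. {w, u} \<in> H \<and> u \<noteq> a')" for w
  have c: "{w, c w} \<in> H \<and> c w \<noteq> a'" if "w \<in> ?P" for w
    using someI_ex[OF other[OF that]] aa' unfolding c_def by auto
  have c': "c w \<notin> ?P" if w: "w \<in> ?P" for w
  proof
    assume "c w \<in> ?P"
    then have "c w \<in> N y" by (rule PN)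
    moreover have "c w \<in> N x" using cross'[OF PN[OF w]] c[OF w] by simp
    ultimately show False using xyd by simp
  qed
  let ?F = "star_cover H a' c"
  obtain M where M: "maximal_matching (del H (insert a' (\<Union>?F))) M"
    using maximal_matching_exists[OF edge_set_del[OF EH]] .
  define X where "X = ?F \<union> M"
  have cc: "\<forall>w\<in>?P. {w, c w} \<in> H \<and> c w \<noteq> a' \<and> c w \<notin> ?P"
    using c c' by simp
  note sc = star_cover_min_edge_dom[OF EH cc M, folded X_def]
  have XE: "X \<subseteq> E" using sc(1) del_subset[of E S] by auto
  have XS: "x \<notin> \<Union>X" "y \<notin> \<Union>X" "z \<notin> \<Union>X" using H_subset[OF sc(1)] xyz by auto
  have HE: "e \<in> E" if "e \<in> H" for e using delD(1)[OF that] .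
  have aF: "a \<in> \<Union>?F"
  proof -
    have "c b = a" using b(1) unfolding c_def by (simp add: insert_commute)
    then show ?thesis using bP unfolding star_cover_def by auto
  qed
  have PX: "{a', w} \<in> E" if "w \<in> ?P" for w using that HE unfolding star_def by simp
  have nS: "a \<notin> S" "a' \<notin> S" using a N_notin by auto
  have nS': "a \<noteq> x" "a \<noteq> y" "a \<noteq> z" "a' \<noteq> x" "a' \<noteq> y" "a' \<noteq> z" using nS S by auto
  have Xpriv: "\<exists>p\<in>H. a \<notin> p \<and> p \<inter> \<Union>(X - {e}) = {}" if e: "e \<in> X" for e
  proof (cases "e \<in> M")
    case True
    have "a \<notin> e" using sc(6)[OF True] aF by auto
    moreover have "e \<in> H" using sc(1) e by auto
    ultimately show ?thesis using sc(5)[OF True] by auto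
  next
    case False
    then obtain w where w: "w \<in> ?P" "e = {w, c w}"
      using e unfolding X_def star_cover_def by auto
    have "a \<noteq> w" using xyd[OF a(1)] PN[OF w(1)] by auto
    then have "a \<notin> {a', w}" using aa' by simp
    moreover have "{a', w} \<in> H" using w(1) unfolding star_def by simp
    moreover have "{a', w} \<inter> \<Union>(X - {e}) = {}" using sc(4)[OF w(1)] w(2) by simp
    ultimately show ?thesis by (intro bexI[of _ "{a', w}"] conjI)
  qed
  have disj: "p \<inter> \<Union>(X \<union> D - {e}) = {}"
    if "p \<in> H" "a \<notin> p" "p \<inter> \<Union>(X - {e}) = {}" "\<And>d. d \<in> D \<Longrightarrow> d \<subseteq> insert a S" for p e D
  proof -
    have "p \<inter> d = {}" if "d \<in> D" for d
      using \<open>\<And>d. d \<in> D \<Longrightarrow> d \<subseteq> insert a S\<close>[OF that] \<open>a \<notin> p\<close> H_notin[OF \<open>p \<in> H\<close>] by auto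
    then show ?thesis using \<open>p \<inter> \<Union>(X - {e}) = {}\<close> by auto
  qed
  \<comment> \<open>\<open>X\<close> need not be a matching near \<open>a'\<close>, so
    \<open>cover\<close> does not apply to it. The edges of \<open>M\<close> in other components
    extend to a maximal matching \<open>M2\<close> of \<open>H\<close>; its edge at \<open>v\<close>
    meets an edge of \<open>M\<close> that belongs to \<open>M2\<close> as well, so the two
    coincide.\<close>
  have coverz: "v \<in> \<Union>X" if v: "v \<in> N z" for v
  proof (rule ccontr)
    assume vX: "v \<notin> \<Union>X"
    let ?MR = "{m \<in> M. \<forall>u\<in>m. \<not> reach a' u}"
    have MH: "M \<subseteq> H" using sc(1) unfolding X_def by simp
    have MR1: "matching ?MR" using matching_subset[OF maximal_matchingD(2)[OF M]] by auto
    have MR2: "?MR \<subseteq> H" using MH by auto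
    obtain M2 where M2: "?MR \<subseteq> M2" "maximal_matching H M2" using maximal_matching_extend[OF EH MR2 MR1] .
    obtain w where w: "{v, w} \<in> M2" "{v, w} \<in> H" "reach v w" using mate[OF M2(2) xyz(6) v] .
    have av: "\<not> reach a' v" using sep[of a' v] a v by simp
    have aw: "\<not> reach a' w" using av reach_sym[OF w(3)] by (meson rtrancl_trans)
    have Fr: "reach a' u" if u: "u \<in> \<Union>?F" for u
    proof -
      obtain q where q: "q \<in> ?P" "u = q \<or> u = c q" using u unfolding star_cover_def by auto
      have "reach a' q" using q(1) reach_edge unfolding star_def by simp
      moreover have "reach q (c q)" using reach_edge c[OF q(1)] by simp
      ultimately show ?thesis using q(2) by (metis rtrancl_trans)
    qed
    have "{v, w} \<inter> insert a' (\<Union>?F) = {}" using Fr av aw by auto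
    from maximal_matchingD(3)[OF M delI[OF w(2) this]] obtain m where m: "m \<in> M" "{v, w} \<inter> m \<noteq> {}" by auto
    have "\<not> reach a' u" if u: "u \<in> m" for u
    proof
      assume r: "reach a' u"
      have "m \<in> H" using m(1) MH by auto
      then have "m \<in> component_edges H a'" using component_edgesI u r by metis
      then have "{v, w} \<in> component_edges H a'" using component_edges_closed[OF EH _ w(2), of m] m(2) by auto
      then show False using component_edges_reach[OF EH, of "{v, w}" a' v] av by simp
    qed
    then have "m \<in> ?MR" using m(1) by simp
    then have "m \<in> M2" using M2(1) by auto
    then have "m = {v, w}" using m(2) matching_eq[OF maximal_matchingD(2)[OF M2(2)] _ w(1)] by auto
    then have "v \<in> \<Union>X" using m(1) unfolding X_def by auto
    then show False using vX by simp
  qed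
  \<comment> \<open>The sets \<open>X \<union> {{x, a}, {y, z}}\<close> and \<open>X \<union> {{x, y}}\<close> are both minimal but differ in size.\<close>
  have "min_edge_dom E (X \<union> {{x, a}, {y, z}})"
  proof (rule min_edge_domI)
    show "X \<union> {{x, a}, {y, z}} \<subseteq> E" using XE T N_edge[OF a(1)] by simp
    show "e \<inter> \<Union>(X \<union> {{x, a}, {y, z}}) \<noteq> {}" if "e \<in> E" for e
      using that
    proof (cases rule: E_cases)
      case 1
      then show ?thesis using sc(3) by auto
    qed (use S in auto)
    fix e assume "e \<in> X \<union> {{x, a}, {y, z}}"
    then consider "e \<in> X" | "e = {x, a}" | "e = {y, z}" by auto
    then show "\<exists>p\<in>E. p \<inter> \<Union>(X \<union> {{x, a}, {y, z}} - {e}) = {}"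
    proof cases
      case 1
      from Xpriv[OF this] obtain p where p: "p \<in> H" "a \<notin> p" "p \<inter> \<Union>(X - {e}) = {}"
        by (elim bexE conjE)
      have "p \<inter> \<Union>(X \<union> {{x, a}, {y, z}} - {e}) = {}"
        by (rule disj[OF p]) (use S in auto)
      then show ?thesis using HE[OF p(1)] by (rule bexI)
    next
      case 2
      have "{x, a'} \<inter> \<Union>(X \<union> {{x, a}, {y, z}} - {e}) = {}"
        using 2 XS sc(2) nS' aa' xyz by auto
      then show ?thesis using N_edge[OF a(2)] by (rule bexI)
    next
      case 3
      have "{y, z} \<inter> \<Union>(X \<union> {{x, a}, {y, z}} - {e}) = {}"
        using 3 XS nS' xyz by auto
      then show ?thesis using T(3) by (rule bexI)
    qed
  qed
  then have 1: "card (X \<union> {{x, a}, {y, z}}) = k" using W unfolding well_dominated_def by simp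
  have "min_edge_dom E (X \<union> {{x, y}})"
  proof (rule min_edge_domI)
    show "X \<union> {{x, y}} \<subseteq> E" using XE T by simp
    show "e \<inter> \<Union>(X \<union> {{x, y}}) \<noteq> {}" if "e \<in> E" for e
      using that
    proof (cases rule: E_cases)
      case 1
      then show ?thesis using sc(3) by auto
    next
      case (2 s t)
      then show ?thesis using S by auto
    next
      case (3 t v)
      then show ?thesis using S coverz[of v] by (cases "t = z") auto
    qed
    fix e assume "e \<in> X \<union> {{x, y}}"
    then consider "e \<in> X" | "e = {x, y}" by auto
    then show "\<exists>p\<in>E. p \<inter> \<Union>(X \<union> {{x, y}} - {e}) = {}"
    proof cases
      case 1
      from Xpriv[OF this] obtain p where p: "p \<in> H" "a \<notin> p" "p \<inter> \<Union>(X - {e}) = {}"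
        by (elim bexE conjE)
      have "p \<inter> \<Union>(X \<union> {{x, y}} - {e}) = {}"
        by (rule disj[OF p]) (use S in auto)
      then show ?thesis using HE[OF p(1)] by (rule bexI)
    next
      case 2
      have "{x, y} \<inter> \<Union>(X \<union> {{x, y}} - {e}) = {}"
        using 2 XS by auto
      then show ?thesis using T(1) by (rule bexI)
    qed
  qed
  then have 2: "card (X \<union> {{x, y}}) = k" using W unfolding well_dominated_def by simp
  have "{x, a} \<notin> X" "{y, z} \<notin> X" "{x, y} \<notin> X" using XS by auto
  moreover have "{x, a} \<noteq> {y, z}" using nS' xyz by auto
  moreover have "finite X" using finite_edges[OF EH sc(1)] .
  ultimately show False using 1 2 by simp
qed

text \<open>\<open>unique_neighbor\<close>, applied in both orientations, leaves \<open>p\<close>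
  and \<open>q\<close> no neighbors in \<open>H\<close> but each other, and by \<open>same\<close>
  every outer neighbor of \<open>x\<close> or \<open>y\<close> lies in their component.\<close>

lemma small_component:
  obtains p q where "N x = {p}" "N y = {q}" "{p, q} \<in> H"
    and "\<forall>e\<in>H. p \<in> e \<or> q \<in> e \<longrightarrow> e = {p, q}"
proof -
  obtain p where p: "p \<in> N x" using outer_ne[of x] xyz by auto
  obtain M where M: "maximal_matching H M" using maximal_matching_exists[OF EH] .
  obtain q where q: "{p, q} \<in> H" using mate[OF M xyz(4) p] by metis
  have qN: "q \<in> N y" using cross[OF p q] .
  have q': "{q, p} \<in> H" using q by (simp add: insert_commute)
  have pw: "w = q" if "{p, w} \<in> H" for w
  proof (rule house_case.unique_neighbor[OF perm_house])
    show "w \<in> N y" using cross[OF p that] .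
    show "q \<in> N y" using qN .
    show "{w, p} \<in> H" using that by (simp add: insert_commute)
    show "{p, q} \<in> H" using q .
  qed
  have qw: "w = p" if "{q, w} \<in> H" for w
  proof (rule unique_neighbor)
    show "w \<in> N x" using cross'[OF qN that] .
    show "{w, q} \<in> H" using that by (simp add: insert_commute)
  qed (use p q' in auto)
  have r: "w \<in> {p, q}" if "reach p w" for w
    using that
  proof (induction rule: rtrancl_induct)
    case (step v w)
    then show ?case using pw[of w] qw[of w] by (auto simp: adj_iff)
  qed simp
  have xyd: "p \<notin> N y" "q \<notin> N x"
    using N_disjoint[OF p, of y] N_disjoint[OF _ qN, of x] xyz by auto
  have "v = p" if "v \<in> N x" for v using r[of v] same[of p v] p that xyd by auto
  then have Nx: "N x = {p}" using p by blast
  have "v = q" if "v \<in> N y" for v using r[of v] same[of p v] p that xyd by auto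
  then have Ny: "N y = {q}" using qN by blast
  have "e = {p, q}" if e: "e \<in> H" "p \<in> e \<or> q \<in> e" for e
    using e(2)
  proof
    assume "p \<in> e"
    then obtain w where "e = {p, w}" using edge_at[OF EH e(1)] by metis
    then show ?thesis using pw e(1) by simp
  next
    assume "q \<in> e"
    then obtain w where "e = {q, w}" using edge_at[OF EH e(1)] by metis
    then show ?thesis using qw e(1) by (auto simp: insert_commute)
  qed
  then have "\<forall>e\<in>H. p \<in> e \<or> q \<in> e \<longrightarrow> e = {p, q}" by (intro ballI impI)
  from that[OF Nx Ny q this] show thesis .
qed

end

text \<open>Components are represented by their reachability sets, so \<open>three_sets\<close>
  applies to the images of the three neighborhoods. The vertex that does not see the common
  component \<open>C\<close> takes the role of \<open>z\<close>.\<close>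

lemma (in triangle_wed) exists_house_case:
  assumes miss: "\<And>t. t \<in> S \<Longrightarrow> \<exists>s\<in>S. \<exists>n\<in>N s. \<forall>w. reach n w \<longrightarrow> w \<notin> N t"
  shows "\<exists>x' y' z'. house_case E k S x' y' z'"
proof -
  let ?c = "\<lambda>v. {w. reach v w}"
  have eq: "reach u v" if "?c u = ?c v" for u v
    using that by (metis mem_Collect_eq rtrancl.rtrancl_refl)
  have neq: "\<not> reach u v" if "?c u \<noteq> ?c v" for u v
  proof
    assume r: "reach u v"
    have "reach u w \<longleftrightarrow> reach v w" for w
      using rtrancl_trans[OF r] rtrancl_trans[OF reach_sym[OF r]] by blast
    then show False using that by simp
  qed
  have hc: "house_case E k S r s t"
    if "triangle_wed E k S r s t" "?c ` N r = {C}" "?c ` N s = {C}" "C \<notin> ?c ` N t" for r s t C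
  proof (rule house_case.intro[OF that(1)], unfold_locales)
    have rs: "?c v = C" if "v \<in> N r \<union> N s" for v
    proof -
      have "?c v \<in> ?c ` N r \<union> ?c ` N s" using imageI[OF that, of ?c] unfolding image_Un .
      then show ?thesis unfolding \<open>?c ` N r = {C}\<close> \<open>?c ` N s = {C}\<close> by simp
    qed
    show "reach v w" if "v \<in> N r \<union> N s" "w \<in> N r \<union> N s" for v w
      using eq[of v w] rs[OF that(1)] rs[OF that(2)] by simp
    show "\<not> reach v w" if "v \<in> N r \<union> N s" "w \<in> N t" for v w
    proof (rule neq)
      have "?c w \<noteq> C" using imageI[OF that(2), of ?c] \<open>C \<notin> ?c ` N t\<close> by metis
      then show "?c v \<noteq> ?c w" using rs[OF that(1)] by simp
    qed
  qed
  have out: "\<exists>s\<in>S. \<exists>n\<in>N s. ?c n \<notin> ?c ` N t \<and> s \<noteq> t" if t: "t \<in> S" for t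
  proof -
    obtain s n where n: "s \<in> S" "n \<in> N s" "\<And>w. reach n w \<Longrightarrow> w \<notin> N t" using miss[OF t] by blast
    have "?c n \<noteq> ?c w" if "w \<in> N t" for w using n(3) eq[of n w] that by blast
    moreover have "s \<noteq> t" using n by blast
    ultimately show ?thesis using n(1,2) by blast
  qed
  have "\<exists>C. ?c ` N x = {C} \<and> ?c ` N y = {C} \<and> C \<notin> ?c ` N z \<or>
      ?c ` N x = {C} \<and> ?c ` N z = {C} \<and> C \<notin> ?c ` N y \<or>
      ?c ` N y = {C} \<and> ?c ` N z = {C} \<and> C \<notin> ?c ` N x"
  proof (rule three_sets)
    show "?c ` N x \<noteq> {}" "?c ` N y \<noteq> {}" "?c ` N z \<noteq> {}" using outer_ne xyz by simp_all
    show "a = b \<or> a = c \<or> b = c" if mem: "a \<in> ?c ` N x" "b \<in> ?c ` N y" "c \<in> ?c ` N z" for a b c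
    proof (rule ccontr)
      assume ne: "\<not> (a = b \<or> a = c \<or> b = c)"
      obtain u where u: "u \<in> N x" "a = ?c u" using mem(1) by blast
      obtain v where v: "v \<in> N y" "b = ?c v" using mem(2) by blast
      obtain w where w: "w \<in> N z" "c = ?c w" using mem(3) by blast
      have "?c u \<noteq> ?c v" "?c u \<noteq> ?c w" "?c v \<noteq> ?c w" using ne unfolding u(2) v(2) w(2) by auto
      then show False using no_three[OF u(1) v(1) w(1)] neq by metis
    qed
    show "\<exists>c\<in>?c ` N x \<union> ?c ` N y. c \<notin> ?c ` N z" using out[OF xyz(6)] unfolding S by blast
    show "\<exists>c\<in>?c ` N y \<union> ?c ` N z. c \<notin> ?c ` N x" using out[OF xyz(4)] unfolding S by blast
    show "\<exists>c\<in>?c ` N x \<union> ?c ` N z. c \<notin> ?c ` N y" using out[OF xyz(5)] unfolding S by blast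
  qed
  then obtain C where "?c ` N x = {C} \<and> ?c ` N y = {C} \<and> C \<notin> ?c ` N z \<or>
      ?c ` N x = {C} \<and> ?c ` N z = {C} \<and> C \<notin> ?c ` N y \<or>
      ?c ` N y = {C} \<and> ?c ` N z = {C} \<and> C \<notin> ?c ` N x" ..
  then show ?thesis
  proof (elim disjE conjE)
    assume "?c ` N x = {C}" "?c ` N y = {C}" "C \<notin> ?c ` N z"
    from hc[OF triangle_wed_axioms this] show ?thesis by blast
  next
    assume "?c ` N x = {C}" "?c ` N z = {C}" "C \<notin> ?c ` N y"
    from hc[OF perm_zxy this(2,1,3)] show ?thesis by blast
  next
    assume "?c ` N y = {C}" "?c ` N z = {C}" "C \<notin> ?c ` N x"
    from hc[OF triangle_wed.perm_zxy[OF perm_yxz] this(2,1,3)] show ?thesis by blast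
  qed
qed

section \<open>The graph outside the house\<close>

locale house_end = house_case +
  fixes p q :: 'a
  assumes Nx: "N x = {p}" and Ny: "N y = {q}" and pq: "{p, q} \<in> H"
    and only: "\<And>e. e \<in> H \<Longrightarrow> p \<in> e \<or> q \<in> e \<Longrightarrow> e = {p, q}"
begin

abbreviation E' where "E' \<equiv> del E {x, y, p, q}"
abbreviation R where "R \<equiv> del E' {z}"

lemma pq_distinct: "p \<noteq> q" "p \<notin> S" "q \<notin> S" "p \<noteq> x" "p \<noteq> y" "p \<noteq> z" "q \<noteq> x" "q \<noteq> y" "q \<noteq> z"
proof -
  show "p \<noteq> q" using edge_neq[OF EH pq] .
  show "p \<notin> S" "q \<notin> S" using H_notin[OF pq] by auto
  then show "p \<noteq> x" "p \<noteq> y" "p \<noteq> z" "q \<noteq> x" "q \<noteq> y" "q \<noteq> z" using S by auto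
qed

lemma house_edges: "{x, p} \<in> E" "{y, q} \<in> E" "{p, q} \<in> E"
  using N_edge[of p x] N_edge[of q y] delD(1)[OF pq] Nx Ny by auto

lemma E'_cases:
  assumes e: "e \<in> E"
  shows "e \<in> E' \<or> e \<in> {{x, y}, {x, z}, {y, z}, {x, p}, {y, q}, {p, q}}"
  using e
proof (cases rule: E_cases)
  case 1
  show ?thesis
  proof (cases "p \<in> e \<or> q \<in> e")
    case False
    then have "e \<inter> {x, y, p, q} = {}" using H_notin[OF 1] S by auto
    from delI[OF e this] show ?thesis ..
  next
    case True
    from only[OF 1 True] show ?thesis by simp
  qed
next
  case (2 s t)
  then have "s \<in> {x, y, z}" "t \<in> {x, y, z}" using S by simp_all
  then have "e \<in> {{x, y}, {x, z}, {y, z}}"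
    using 2(3,4) by (elim insertE emptyE) (simp_all add: insert_commute)
  then show ?thesis by (elim insertE emptyE) simp_all
next
  case (3 t v)
  show ?thesis
  proof (cases "t = z")
    case True
    have "v \<noteq> p" "v \<noteq> q"
      using N_disjoint[of v z x] N_disjoint[of v z y] 3 True Nx Ny xyz by auto
    moreover have "v \<noteq> x" "v \<noteq> y" using N_notin[OF 3(2)] S by auto
    ultimately have "e \<inter> {x, y, p, q} = {}" using 3(3) True xyz pq_distinct by auto
    from delI[OF e this] show ?thesis ..
  next
    case False
    then have "t = x \<or> t = y" using 3(1) S by simp
    then have "e \<in> {{x, p}, {y, q}}" using 3(2,3) Nx Ny by auto
    then show ?thesis by (elim insertE emptyE) simp_all
  qed
qed

text \<open>In \<open>H\<close> the vertex \<open>q\<close> has only the neighbor \<open>p\<close>,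
  so deleting \<open>p\<close> already removes its edge there. In this form \<open>R\<close> is what
  deleting a matching leaves.\<close>

lemma R_eq: "R = del E {x, p, y, z}"
proof
  show "R \<subseteq> del E {x, p, y, z}" unfolding del_def by auto
  show "del E {x, p, y, z} \<subseteq> R"
  proof
    fix e assume e: "e \<in> del E {x, p, y, z}"
    note e' = delD[OF e]
    have "e \<in> H" by (rule delI[OF e'(1)]) (use e'(2) S in auto)
    then have "q \<notin> e" using only[of e] e'(2) by auto
    then have "e \<in> E'" by (intro delI[OF e'(1)]) (use e'(2) in auto)
    then show "e \<in> R" by (rule delI) (use e'(2) in auto)
  qed
qed

text \<open>Deleting the ends of \<open>{x, p}\<close>, \<open>{y, q}\<close> keeps
  \<open>z\<close>, while deleting those of \<open>{x, p}\<close>, \<open>{y, z}\<close> removes it.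
  Both matchings have two edges, whence the common number \<open>k - 2\<close> here and in
  \<open>well_dominated_R\<close>.\<close>

lemma well_dominated_E': "well_dominated E' (k - 2)" and k2: "2 \<le> k"
proof -
  have m: "matching {{x, p}, {y, q}}" by (rule matching2) (use xyz pq_distinct in auto)
  have sub: "{{x, p}, {y, q}} \<subseteq> E" using house_edges by simp
  have c: "card {{x, p}, {y, q}} = 2"
    using xyz pq_distinct by (simp add: doubleton_eq_iff)
  have u: "\<Union>{{x, p}, {y, q}} = {x, y, p, q}" by auto
  show "well_dominated E' (k - 2)" using well_dominated_del(1)[OF E W sub m] c u by simp
  show "2 \<le> k" using well_dominated_del(2)[OF E W sub m] c by simp
qed

lemma well_dominated_R: "well_dominated R (k - 2)"
proof -
  have m: "matching {{x, p}, {y, z}}" by (rule matching2) (use xyz pq_distinct in auto)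
  have sub: "{{x, p}, {y, z}} \<subseteq> E" using house_edges T by simp
  have c: "card {{x, p}, {y, z}} = 2"
    using xyz pq_distinct by (simp add: doubleton_eq_iff)
  have u: "\<Union>{{x, p}, {y, z}} = {x, p, y, z}" by auto
  show ?thesis using well_dominated_del(1)[OF E W sub m] c u R_eq by simp
qed

lemma ER: "edge_set R"
  using edge_set_del[OF edge_set_del[OF E]] .

lemma RE: "e \<in> R \<Longrightarrow> e \<in> E" and R_avoid: "e \<in> R \<Longrightarrow> e \<inter> {x, y, z, p, q} = {}"
  unfolding del_def by auto

text \<open>Otherwise a star cover at \<open>u\<close> in \<open>R\<close> gives a minimal set
  \<open>X\<close> of \<open>k - 2\<close> edges that misses \<open>u\<close>. The star at
  \<open>x\<close> adds three edges, with private edges \<open>{p, q}\<close>, \<open>{y, q}\<close>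
  and \<open>{z, u}\<close>, which makes \<open>k + 1\<close>. If \<open>u\<close> has no neighbor
  in \<open>R\<close>, the star cover is empty and the same argument applies.\<close>

lemma support:
  assumes u: "{z, u} \<in> E'"
  obtains a where "{u, a} \<in> R" "\<And>w. {a, w} \<in> R \<Longrightarrow> w = u"
proof (rule ccontr)
  assume "\<not> thesis"
  with that have nl: "\<exists>w. {a, w} \<in> R \<and> w \<noteq> u" if "{u, a} \<in> R" for a
    using that by blast
  define c where "c a = (SOME w. {a, w} \<in> R \<and> w \<noteq> u)" for a
  have c: "{a, c a} \<in> R \<and> c a \<noteq> u" if "a \<in> star R u" for a
    using someI_ex[OF nl[of a]] that unfolding c_def star_def by simp
  have uE: "{z, u} \<in> E" and ud: "{z, u} \<inter> {x, y, p, q} = {}" using delD[OF u] by auto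
  have uz: "u \<noteq> z" using edge_neq[OF E uE] by auto
  \<comment> \<open>A further neighbor of \<open>a\<close> adjacent to \<open>u\<close> would give a
    triangle that avoids \<open>x\<close>.\<close>
  have cc: "\<forall>a\<in>star R u. {a, c a} \<in> R \<and> c a \<noteq> u \<and> c a \<notin> star R u"
  proof (intro ballI conjI)
    fix a assume a: "a \<in> star R u"
    show "{a, c a} \<in> R" "c a \<noteq> u" using c[OF a] by auto
    show "c a \<notin> star R u"
    proof
      assume "c a \<in> star R u"
      then have "{u, a} \<in> E" "{a, c a} \<in> E" "{u, c a} \<in> E" "{u, a} \<in> R" "{a, c a} \<in> R"
        using a c[OF a] RE unfolding star_def by auto
      then have "{u, a, c a} = S" "{u, a} \<inter> {x} = {}" "{a, c a} \<inter> {x} = {}"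
        using uniq[of u a "c a"] R_avoid by auto
      then show False using xyz by auto
    qed
  qed
  obtain M where M: "maximal_matching (del R (insert u (\<Union>(star_cover R u c)))) M"
    using maximal_matching_exists[OF edge_set_del[OF ER]] .
  define X where "X = star_cover R u c \<union> M"
  note sc = star_cover_min_edge_dom[OF ER cc M, folded X_def]
  have XE: "X \<subseteq> E" using sc(1) RE by auto
  have Xav: "v \<notin> \<Union>X" if "v \<in> {x, y, z, p, q}" for v
  proof
    assume "v \<in> \<Union>X"
    then obtain e where "e \<in> X" "v \<in> e" by auto
    then show False using R_avoid[of e] sc(1) that by auto
  qed
  have Xn: "x \<notin> \<Union>X" "y \<notin> \<Union>X" "z \<notin> \<Union>X" "p \<notin> \<Union>X" "q \<notin> \<Union>X" by (rule Xav, simp)+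
  let ?D = "{{x, p}, {x, y}, {x, z}}"
  have "min_edge_dom E (X \<union> ?D)"
  proof (rule min_edge_domI)
    show "X \<union> ?D \<subseteq> E" using XE house_edges T by simp
    show "e \<inter> \<Union>(X \<union> ?D) \<noteq> {}" if e: "e \<in> E" for e
    proof (cases "e \<in> R")
      case True
      then show ?thesis using sc(3)[OF True] by auto
    next
      case False
      have "z \<in> e" if "e \<in> E'" using delI[OF that, of "{z}"] False by blast
      then have "x \<in> e \<or> y \<in> e \<or> z \<in> e \<or> p \<in> e" using E'_cases[OF e] by auto
      then show ?thesis by auto
    qed
    fix e assume "e \<in> X \<union> ?D"
    then consider "e \<in> X" | "e = {x, p}" | "e = {x, y}" | "e = {x, z}" by auto
    then show "\<exists>r\<in>E. r \<inter> \<Union>(X \<union> ?D - {e}) = {}"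
    proof cases
      case 1
      from min_edge_domD(3)[OF sc(7) 1] obtain r where r: "r \<in> R" "r \<inter> \<Union>(X - {e}) = {}" ..
      have "r \<inter> \<Union>(X \<union> ?D - {e}) = {}" using r(2) R_avoid[OF r(1)] by auto
      then show ?thesis using RE[OF r(1)] by (rule bexI)
    next
      case 2
      have "{p, q} \<inter> \<Union>(X \<union> ?D - {e}) = {}" using 2 Xn pq_distinct by auto
      then show ?thesis using house_edges(3) by (rule bexI)
    next
      case 3
      have "{y, q} \<inter> \<Union>(X \<union> ?D - {e}) = {}" using 3 Xn pq_distinct xyz by auto
      then show ?thesis using house_edges(2) by (rule bexI)
    next
      case 4
      have "{z, u} \<inter> \<Union>(X \<union> ?D - {e}) = {}" using 4 Xn pq_distinct xyz ud uz sc(2) by auto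
      then show ?thesis using uE by (rule bexI)
    qed
  qed
  then have 1: "card (X \<union> ?D) = k" using W unfolding well_dominated_def by simp
  have "card X = k - 2" using well_dominated_R sc(7) unfolding well_dominated_def by simp
  moreover have "X \<inter> ?D = {}" using Xn by auto
  moreover have "card ?D = 3" using xyz pq_distinct by (simp add: doubleton_eq_iff)
  moreover have "finite X" using finite_edges[OF ER sc(1)] .
  ultimately have "card (X \<union> ?D) = k - 2 + 3" using card_Un_disjoint[of X ?D] by simp
  then show False using 1 k2 by simp
qed

text \<open>The house is attached to the rest only at \<open>z\<close>. A walk that leaves it does
  so at its own start vertex, from which reachability begins anew.\<close>

lemma reach_E':
  assumes "(z, v) \<in> (adj E)\<^sup>*"
  shows "v \<in> {x, y, p, q} \<or> (z, v) \<in> (adj E')\<^sup>*"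
  using assms
proof (induction rule: rtrancl_induct)
  case (step v w)
  then have vw: "{v, w} \<in> E" by (simp add: adj_iff)
  show ?case
  proof (cases "{v, w} \<in> E'")
    case True
    then have "v \<notin> {x, y, p, q}" using delD(2)[OF True] by auto
    then show ?thesis using step.IH True by (auto simp: adj_iff intro: rtrancl_into_rtrancl)
  next
    case False
    then have "{v, w} \<in> {{x, y}, {x, z}, {y, z}, {x, p}, {y, q}, {p, q}}" using E'_cases[OF vw] by simp
    then have "w \<in> {x, y, z, p, q}" by (auto simp: doubleton_eq_iff)
    then show ?thesis by auto
  qed
qed simp

lemma bipartite:
  assumes "conn_from E z"
  obtains A where "finite A" "two_coloring E' A" "z \<notin> A" "card A = k - 2"
proof -
  have "edge_set E'" using edge_set_del[OF E] .
  moreover have "trifree E'"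
    unfolding trifree_def
  proof (intro allI impI notI)
    fix a b c assume abc: "{a, b} \<in> E'" "{b, c} \<in> E'" "{a, c} \<in> E'"
    have "{a, b, c} = S" using uniq[of a b c] abc[THEN delD(1)] by simp
    then show False using xyz(4) abc[THEN delD(2)] by auto
  qed
  moreover have "conn_from E' z"
    unfolding conn_from_def
  proof
    fix v assume "v \<in> \<Union>E'"
    then obtain e where e: "e \<in> E'" "v \<in> e" by auto
    then have "v \<in> \<Union>E" "v \<notin> {x, y, p, q}" using delD[OF e(1)] by auto
    then show "(z, v) \<in> (adj E')\<^sup>*" using reach_E' assms unfolding conn_from_def by blast
  qed
  \<comment> \<open>Equal numbers with and without \<open>z\<close> select the first alternative of
    \<open>equimatchable_two_coloring\<close>, which puts \<open>z\<close> outside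
    \<open>A\<close>.\<close>
  ultimately show thesis
    using equimatchable_two_coloring[of E' z "k - 2"] well_dominated_equimatchable[OF well_dominated_E'] well_dominated_equimatchable[OF well_dominated_R] that by blast
qed

end

lemma (in house_case) exists_house_end: "\<exists>p q. house_end E k S x y z p q"
proof -
  obtain p q where pq: "N x = {p}" "N y = {q}" "{p, q} \<in> H"
      "\<forall>e\<in>H. p \<in> e \<or> q \<in> e \<longrightarrow> e = {p, q}"
    by (rule small_component)
  have "house_end E k S x y z p q"
  proof
    show "N x = {p}" "N y = {q}" "{p, q} \<in> H" using pq(1-3) .
    show "e = {p, q}" if "e \<in> H" "p \<in> e \<or> q \<in> e" for e
      using mp[OF bspec[OF pq(4) that(1)] that(2)] .
  qed
  then show ?thesis by (intro exI)
qed

section \<open>Translation to the graph vocabulary\<close>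

lemma simple_graph_edge_set:
  assumes "simple_graph G"
  shows "edge_set (edges G)"
proof -
  have "edges G \<subseteq> Pow (verts G)" "finite (verts G)" using assms unfolding simple_graph_def by auto
  then have "finite (edges G)" using finite_subset by blast
  then show ?thesis using assms unfolding edge_set_def simple_graph_def by simp
qed

lemma edge_dominating_iff:
  assumes "edge_set (edges G)"
  shows "edge_dominating G F \<longleftrightarrow> F \<subseteq> edges G \<and> (\<forall>e\<in>edges G. e \<inter> \<Union>F \<noteq> {})"
proof -
  have "(e \<in> F \<or> (\<exists>f\<in>F. e \<inter> f \<noteq> {})) \<longleftrightarrow> e \<inter> \<Union>F \<noteq> {}" if "e \<in> edges G" for e
    using edge_setD(1)[OF assms that] by auto
  then show ?thesis unfolding edge_dominating_def by simp
qed

text \<open>A proper subset of \<open>F\<close> is contained in some \<open>F - {e}\<close>, and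
  domination is monotone, so minimality only has to be tested for single deletions. An edge left
  undominated by \<open>F - {e}\<close> is a private edge of \<open>e\<close>.\<close>

lemma minimal_edge_dominating_iff:
  assumes E: "edge_set (edges G)"
  shows "minimal_edge_dominating G F \<longleftrightarrow> min_edge_dom (edges G) F"
proof
  assume F: "minimal_edge_dominating G F"
  then have dF: "F \<subseteq> edges G" "\<And>e. e \<in> edges G \<Longrightarrow> e \<inter> \<Union>F \<noteq> {}"
    unfolding minimal_edge_dominating_def edge_dominating_iff[OF E] by auto
  show "min_edge_dom (edges G) F"
  proof (rule min_edge_domI[OF dF])
    fix e assume e: "e \<in> F"
    then have "F - {e} \<subset> F" by auto
    then have "\<not> edge_dominating G (F - {e})" using F unfolding minimal_edge_dominating_def by simp
    moreover have "F - {e} \<subseteq> edges G" using dF(1) by auto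
    ultimately show "\<exists>p\<in>edges G. p \<inter> \<Union>(F - {e}) = {}"
      unfolding edge_dominating_iff[OF E] by simp
  qed
next
  assume F: "min_edge_dom (edges G) F"
  show "minimal_edge_dominating G F"
    unfolding minimal_edge_dominating_def edge_dominating_iff[OF E]
  proof (intro conjI allI impI ballI notI)
    show "F \<subseteq> edges G" using min_edge_domD(1)[OF F] .
    show "e \<inter> \<Union>F = {} \<Longrightarrow> False" if "e \<in> edges G" for e using min_edge_domD(2)[OF F that] by simp
    fix F' assume F': "F' \<subset> F" "F' \<subseteq> edges G \<and> (\<forall>e\<in>edges G. e \<inter> \<Union>F' \<noteq> {})"
    then obtain e where e: "e \<in> F" "F' \<subseteq> F - {e}" by auto
    obtain p where p: "p \<in> edges G" "p \<inter> \<Union>(F - {e}) = {}" using min_edge_domD(3)[OF F e(1)] by auto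
    have "\<Union>F' \<subseteq> \<Union>(F - {e})" using e(2) by (rule Union_mono)
    then have "p \<inter> \<Union>F' = {}" using p(2) by blast
    then show False using F'(2) p(1) by simp
  qed
qed

lemma well_edge_dominated_iff:
  assumes E: "edge_set (edges G)"
  shows "well_edge_dominated G \<longleftrightarrow> (\<exists>k. well_dominated (edges G) k)"
proof -
  obtain M where "min_edge_dom (edges G) M" using maximal_matching_exists[OF E] maximal_matching_min_edge_dom by metis
  then show ?thesis
    unfolding well_edge_dominated_def minimal_edge_dominating_iff[OF E] well_dominated_def by metis
qed

lemma delete_verts_simps:
  assumes "simple_graph G"
  shows "verts (delete_verts G S) = verts G - S" "edges (delete_verts G S) = del (edges G) S"
    and "simple_graph (delete_verts G S)"
proof -
  show v: "verts (delete_verts G S) = verts G - S"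
    unfolding delete_verts_def induced_subgraph_def by auto
  show e: "edges (delete_verts G S) = del (edges G) S"
    using assms unfolding delete_verts_def induced_subgraph_def simple_graph_def del_def by auto
  show "simple_graph (delete_verts G S)"
    using assms unfolding simple_graph_def v e del_def by auto
qed

lemma graph_isoI:
  assumes "simple_graph G" "inj_on f (verts G)" "verts K = f ` verts G" "edges K = (`) f ` edges G"
  shows "graph_iso G K"
  unfolding graph_iso_def
proof (intro exI conjI ballI)
  show "bij_betw f (verts G) (verts K)" using assms unfolding bij_betw_def by simp
  fix u v assume uv: "u \<in> verts G" "v \<in> verts G"
  show "{u, v} \<in> edges G \<longleftrightarrow> {f u, f v} \<in> edges K"
  proof
    assume "{u, v} \<in> edges G"
    from imageI[OF this, of "(`) f"] show "{f u, f v} \<in> edges K" unfolding assms(4) by simp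
  next
    assume "{f u, f v} \<in> edges K"
    then obtain e where e: "e \<in> edges G" "f ` {u, v} = f ` e" unfolding assms(4) by auto
    have "e \<subseteq> verts G" using assms(1) e(1) unfolding simple_graph_def by simp
    then have "e = {u, v}" using inj_on_image_eq_iff[OF assms(2), of "{u, v}" e] e(2) uv by simp
    then show "{u, v} \<in> edges G" using e(1) by simp
  qed
qed

lemma triangle_ofI:
  assumes G: "simple_graph G" and abc: "{a, b} \<in> edges G" "{b, c} \<in> edges G" "{a, c} \<in> edges G"
  shows "triangle_of G (Graph {a, b, c} {{a, b}, {a, c}, {b, c}})"
proof -
  let ?T = "Graph {a, b, c} {{a, b}, {a, c}, {b, c}}"
  have ne: "a \<noteq> b" "b \<noteq> c" "a \<noteq> c" using edge_neq[OF simple_graph_edge_set[OF G]] abc by auto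
  have "{a, b} \<subseteq> verts G" "{b, c} \<subseteq> verts G"
    using G abc unfolding simple_graph_def by auto
  then have sub: "subgraph ?T G"
    using abc ne unfolding subgraph_def simple_graph_def by auto
  let ?f = "\<lambda>v. if v = a then 0 else if v = b then 1 else (2::nat)"
  have "graph_iso ?T (complete_graph 3)"
  proof (rule graph_isoI)
    show "simple_graph ?T" using sub unfolding subgraph_def by simp
    show "inj_on ?f (verts ?T)" using ne by (auto simp: inj_on_def)
    have three: "{..<3} = {0, 1, 2 :: nat}" by auto
    show "verts (complete_graph 3) = ?f ` verts ?T"
      using ne unfolding complete_graph_def three by auto
    have "{e. e \<subseteq> {0, 1, 2 :: nat} \<and> card e = 2} = {{0, 1}, {0, 2}, {1, 2}}"
    proof
      show "{e. e \<subseteq> {0, 1, 2 :: nat} \<and> card e = 2} \<subseteq> {{0, 1}, {0, 2}, {1, 2}}"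
        by (auto simp: card_2_iff)
    qed auto
    then show "edges (complete_graph 3) = (`) ?f ` edges ?T"
      using ne unfolding complete_graph_def three by (simp add: insert_commute)
  qed
  then show ?thesis using sub unfolding triangle_of_def by simp
qed

section \<open>Reachability after deletion of vertices\<close>

lemma reachable_iff: "reachable G u v \<longleftrightarrow> (u, v) \<in> (adj (edges G))\<^sup>*"
  unfolding reachable_def adj_def ..

text \<open>The second alternative records the first entry into \<open>D\<close>; further steps of
  the walk cannot undo it.\<close>

lemma reach_boundary:
  assumes "(v, w) \<in> (adj E)\<^sup>*" "v \<notin> D"
  shows "(v, w) \<in> (adj (del E D))\<^sup>* \<and> w \<notin> D \<or>
    (\<exists>n s. (v, n) \<in> (adj (del E D))\<^sup>* \<and> n \<notin> D \<and> s \<in> D \<and> {n, s} \<in> E)"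
  using assms(1)
proof (induction rule: rtrancl_induct)
  case (step u w)
  then have uw: "{u, w} \<in> E" by (simp add: adj_iff)
  from step.IH show ?case
  proof
    assume u: "(v, u) \<in> (adj (del E D))\<^sup>* \<and> u \<notin> D"
    show ?thesis
    proof (cases "w \<in> D")
      case True
      then show ?thesis using u uw by blast
    next
      case False
      then have "(u, w) \<in> adj (del E D)" using u uw by (simp add: adj_iff del_def)
      then show ?thesis using u False by (meson rtrancl_into_rtrancl)
    qed
  qed blast
qed (use assms(2) in simp)

text \<open>One of two components differs from that of \<open>t\<close>. A walk in \<open>G\<close>
  from one of its vertices to \<open>D\<close> first enters \<open>D\<close> from a vertex
  \<open>n\<close> that still belongs to that component.\<close>

lemma second_component:
  assumes G: "simple_graph G" "connected_graph G"
    and two: "2 \<le> card {C \<in> components (delete_verts G D). nontrivial C}"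
    and s0: "s0 \<in> D" "s0 \<in> verts G"
  shows "\<exists>n s. (t, n) \<notin> (adj (del (edges G) D))\<^sup>* \<and> n \<notin> D \<and> s \<in> D \<and> {s, n} \<in> edges G"
proof -
  let ?D = "delete_verts G D" and ?r = "adj (del (edges G) D)"
  let ?C = "\<lambda>v. induced_subgraph ?D {u. reachable ?D v u}"
  have "\<not> {C \<in> components ?D. nontrivial C} \<subseteq> {?C t}"
  proof
    assume "{C \<in> components ?D. nontrivial C} \<subseteq> {?C t}"
    then have "card {C \<in> components ?D. nontrivial C} \<le> card {?C t}" by (intro card_mono) simp_all
    then show False using two by simp
  qed
  then obtain v where v: "v \<in> verts ?D" "?C v \<noteq> ?C t" unfolding components_def by blast
  have tv: "(t, v) \<notin> ?r\<^sup>*"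
  proof
    assume tv: "(t, v) \<in> ?r\<^sup>*"
    have "reachable ?D v u \<longleftrightarrow> reachable ?D t u" for u
      unfolding reachable_iff delete_verts_simps(2)[OF G(1)]
      using rtrancl_trans[OF tv] rtrancl_trans[OF reach_sym[OF tv]] by blast
    then show False using v(2) by simp
  qed
  have vD: "v \<notin> D" "v \<in> verts G" using v(1) unfolding delete_verts_simps(1)[OF G(1)] by auto
  have "(v, s0) \<in> (adj (edges G))\<^sup>*"
    using G(2) vD s0 unfolding connected_graph_def reachable_iff by blast
  from reach_boundary[OF this vD(1)] s0(1) obtain n s where
    n: "(v, n) \<in> ?r\<^sup>*" "n \<notin> D" "s \<in> D" "{n, s} \<in> edges G" by blast
  have "(t, n) \<notin> ?r\<^sup>*" using tv reach_sym[OF n(1)] by (meson rtrancl_trans)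
  then show ?thesis using n by (metis insert_commute)
qed

lemma house_end_family:
  assumes G: "simple_graph G" "connected_graph G" and he: "house_end (edges G) k S x y z p q"
  shows "G \<in> house_family"
proof -
  interpret house_end "edges G" k S x y z p q by (rule he)
  define G' where "G' = delete_verts G {x, y, p, q}"
  have G': "verts G' = verts G - {x, y, p, q}" "edges G' = E'" "simple_graph G'"
    unfolding G'_def using delete_verts_simps[OF G(1)] by simp_all
  have Gz: "verts (delete_verts G' {z}) = verts G' - {z}" "edges (delete_verts G' {z}) = R"
    using delete_verts_simps[OF G'(3)] G'(2) by simp_all
  have V: "e \<subseteq> verts G" if "e \<in> edges G" for e using G(1) that unfolding simple_graph_def by simp
  have V': "e \<subseteq> verts G'" if "e \<in> E'" for e using G'(2,3) that unfolding simple_graph_def by simp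
  have xV: "x \<in> verts G" "y \<in> verts G" "z \<in> verts G" "p \<in> verts G" "q \<in> verts G"
    using V[OF T(1)] V[OF T(2)] V[OF house_edges(3)] by auto
  have zV: "z \<in> verts G'" using xV xyz pq_distinct unfolding G'(1) by auto
  have finV: "finite (verts G')" using G'(3) unfolding simple_graph_def by simp
  have "conn_from (edges G) z"
    unfolding conn_from_def
  proof
    fix v assume "v \<in> \<Union>(edges G)"
    then have "v \<in> verts G" using V by auto
    then show "(z, v) \<in> (adj (edges G))\<^sup>*"
      using G(2) xV(3) unfolding connected_graph_def reachable_iff by simp
  qed
  then obtain A where A: "finite A" "two_coloring E' A" "z \<notin> A" "card A = k - 2" by (rule bipartite)
  obtain M where M: "maximal_matching R M" using maximal_matching_exists[OF ER] .
  have ME: "M \<subseteq> E'" using maximal_matchingD(1)[OF M] del_subset[of E' "{z}"] by simp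
  have cM: "card M = k - 2" using well_dominated_equimatchable[OF well_dominated_R] M unfolding equimatchable_def by simp
  have MV: "\<Union>M \<subseteq> verts G' - {z}"
  proof
    fix v assume "v \<in> \<Union>M"
    then obtain e where e: "e \<in> R" "v \<in> e" using maximal_matchingD(1)[OF M] by auto
    show "v \<in> verts G' - {z}" using V'[OF delD(1)[OF e(1)]] delD(2)[OF e(1)] e(2) by auto
  qed
  have AM: "A \<subseteq> \<Union>M" using two_coloring_saturated[OF A(2) ME maximal_matchingD(2)[OF M] A(1)] cM A(4) by simp
  have AV: "A \<subseteq> verts G'" using subset_trans[OF AM MV] by auto
  define B where "B = verts G' - A"
  have zB: "z \<in> B" using zV A(3) unfolding B_def by simp
  have MB: "\<Union>M - A \<subseteq> B - {z}" using Diff_mono[OF MV subset_refl, of A] unfolding B_def by auto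
  have finB: "finite B" using finV unfolding B_def by simp
  \<comment> \<open>\<open>M\<close> saturates \<open>A\<close> and avoids \<open>z\<close>, so
    \<open>B\<close> contains the \<open>k - 2\<close> partners of \<open>A\<close> and
    \<open>z\<close> besides.\<close>
  have "card (\<Union>M - A) \<le> card (B - {z})" by (rule card_mono[OF _ MB]) (use finB in simp)
  then have "card A \<le> card (B - {z})"
    using two_coloring_card(2)[OF A(2) ME maximal_matchingD(2)[OF M]] cM A(4) by simp
  then have AB: "card A < card B" using card_Suc_Diff1[OF finB zB] by simp
  have bp: "bipartition G' A B"
    unfolding bipartition_def
  proof (intro conjI ballI)
    show "verts G' = A \<union> B" "A \<inter> B = {}" using AV unfolding B_def by auto
    fix e assume "e \<in> edges G'"
    then have e: "e \<in> E'" using G'(2) by simp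
    obtain a b where ab: "a \<in> A" "b \<notin> A" "e = {a, b}" using two_coloring_cases[OF A(2) e] .
    then have "b \<in> B" using V'[OF e] unfolding B_def by simp
    then show "\<exists>a\<in>A. \<exists>b\<in>B. e = {a, b}" using ab(1,3) by (intro bexI)
  qed
  have wed': "well_edge_dominated G'"
    using well_edge_dominated_iff[OF simple_graph_edge_set[OF G'(3)]] well_dominated_E' G'(2) by auto
  have wedz: "well_edge_dominated (delete_verts G' {z})"
    using well_edge_dominated_iff[of "delete_verts G' {z}"] ER well_dominated_R Gz(2) by auto
  have "support_vertex (delete_verts G' {z}) u" if u: "u \<in> neighbors G' z" for u
  proof -
    have zu: "{z, u} \<in> E'" using u G'(2) unfolding neighbors_def by simp
    obtain a where a: "{u, a} \<in> R" "\<And>w. {a, w} \<in> R \<Longrightarrow> w = u" using support[OF zu] by metis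
    have "{e \<in> R. a \<in> e} = {{u, a}}"
    proof
      show "{{u, a}} \<subseteq> {e \<in> R. a \<in> e}" using a(1) by simp
      show "{e \<in> R. a \<in> e} \<subseteq> {{u, a}}"
      proof
        fix e assume "e \<in> {e \<in> R. a \<in> e}"
        then have e: "e \<in> R" "a \<in> e" by simp_all
        obtain w where w: "e = {a, w}" using edge_at[OF ER e] .
        have "w = u" by (rule a(2)) (use w e(1) in simp)
        then show "e \<in> {{u, a}}" using w by (simp add: insert_commute)
      qed
    qed
    then have "degree (delete_verts G' {z}) a = 1" unfolding degree_def Gz(2) by simp
    moreover have "a \<in> neighbors (delete_verts G' {z}) u" using a(1) Gz(2) unfolding neighbors_def by simp
    moreover have "u \<in> verts (delete_verts G' {z})"
      using V'[OF zu] edge_neq[OF E delD(1)[OF zu]] unfolding Gz(1) by auto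
    ultimately show ?thesis unfolding support_vertex_def by auto
  qed
  then have sd: "strongly_detachable G' A B z"
    unfolding strongly_detachable_def using G'(3) wed' bp AB zB wedz by simp
  \<comment> \<open>The triangle \<open>x\<close>, \<open>y\<close>, \<open>z\<close> becomes
    \<open>p_3\<close>, \<open>p_4\<close>, \<open>p_5\<close>, and \<open>p\<close>,
    \<open>q\<close> become \<open>p_2\<close>, \<open>p_1\<close>. The map \<open>h\<close> is the
    quotient map used by \<open>identify\<close>.\<close>
  define f :: "'a \<Rightarrow> nat + 'a" where
    "f v = (if v = x then Inl 3 else if v = y then Inl 4 else if v = p then Inl 2
      else if v = q then Inl 1 else if v = z then Inl 5 else Inr v)" for v
  define h :: "nat + 'a \<Rightarrow> nat + 'a" where "h = (\<lambda>v. if v = Inr z then Inl 5 else v)"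
  have fx: "f x = Inl 3" "f y = Inl 4" "f p = Inl 2" "f q = Inl 1" "f z = Inl 5"
    using xyz pq_distinct unfolding f_def by auto
  have hI: "h (Inl i) = Inl i" for i unfolding h_def by simp
  have hf: "h (Inr v) = f v" if "v \<notin> {x, y, p, q}" for v using that unfolding h_def f_def by auto
  have iso: "graph_iso G (identify (Inl 5) (Inr z) (disjoint_union house G'))"
  proof (rule graph_isoI[OF G(1)])
    show "inj_on f (verts G)" unfolding f_def by (auto simp: inj_on_def split: if_splits)
    have "verts G = {x, y, p, q, z} \<union> verts G'" using xV G'(1) by auto
    then have "f ` verts G = f ` {x, y, p, q, z} \<union> f ` verts G'" by (simp only: image_Un)
    also have "f ` {x, y, p, q, z} = h ` Inl ` {1, 2, 3, 4, 5}" using fx hI by auto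
    also have "f ` verts G' = h ` Inr ` verts G'"
      unfolding image_image by (rule image_cong) (use hf G'(1) in auto)
    finally have "f ` verts G = h ` (Inl ` {1, 2, 3, 4, 5} \<union> Inr ` verts G')" by (simp only: image_Un)
    then show "verts (identify (Inl 5) (Inr z) (disjoint_union house G')) = f ` verts G"
      unfolding identify_def disjoint_union_def house_def Let_def h_def Plus_def by simp
    let ?six = "{{q, p}, {p, x}, {x, y}, {y, q}, {x, z}, {y, z}}"
    have "edges G = ?six \<union> E'"
    proof
      show "edges G \<subseteq> ?six \<union> E'"
      proof
        fix e assume "e \<in> edges G"
        from E'_cases[OF this] show "e \<in> ?six \<union> E'"
          by (elim disjE insertE emptyE) (simp_all add: insert_commute)
      qed
      show "?six \<union> E' \<subseteq> edges G"
        using T house_edges del_subset[of "edges G" "{x, y, p, q}"] by (simp add: insert_commute)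
    qed
    from arg_cong[OF this, of "image (image f)"]
    have "(`) f ` edges G = (`) f ` ?six \<union> (`) f ` E'" unfolding image_Un .
    also have "(`) f ` ?six = (`) h ` (`) Inl ` {{1, 2}, {2, 3}, {3, 4}, {4, 1}, {3, 5}, {4, 5}}"
      using fx hI by simp
    also have "(`) f ` E' = (`) h ` (`) Inr ` E'"
      unfolding image_image[of "(`) h"]
    proof (rule image_cong)
      fix e assume e: "e \<in> E'"
      show "f ` e = h ` Inr ` e"
        unfolding image_image
      proof (rule image_cong)
        fix v assume "v \<in> e"
        then have "v \<notin> {x, y, p, q}" using delD(2)[OF e] by auto
        then show "f v = h (Inr v)" by (rule hf[symmetric])
      qed simp
    qed simp
    finally show "edges (identify (Inl 5) (Inr z) (disjoint_union house G')) = (`) f ` edges G"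
      unfolding identify_def disjoint_union_def house_def Let_def h_def G'(2) by (simp only: image_Un ugraph.sel)
  qed
  show ?thesis
    unfolding house_family_def mem_Collect_eq
    by (intro conjI exI) (rule G(1) G'(3) wed' bp AB sd iso)+
qed

theorem theorem9:
  fixes G :: "'a ugraph" and x y z :: 'a
  assumes "simple_graph G"
    and "connected_graph G"
    and "well_edge_dominated G"
    and "{T. triangle_of G T} = {Graph {x, y, z} {{x, y}, {x, z}, {y, z}}}"
    and "\<forall>f\<in>{{x, y}, {x, z}, {y, z}}.
           2 \<le> card {C \<in> components (delete_verts G f). nontrivial C}"
    and "3 \<le> degree G x" and "3 \<le> degree G y" and "3 \<le> degree G z"
  shows "G \<in> house_family"
proof -
  let ?E = "edges G" and ?S = "{x, y, z}"
  have E: "edge_set ?E" using simple_graph_edge_set[OF assms(1)] .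
  obtain k where k: "well_dominated ?E k" using assms(3) well_edge_dominated_iff[OF E] by auto
  have "triangle_of G (Graph ?S {{x, y}, {x, z}, {y, z}})" using assms(4) by blast
  then have T: "{x, y} \<in> ?E" "{x, z} \<in> ?E" "{y, z} \<in> ?E"
    unfolding triangle_of_def subgraph_def by auto
  have ne: "x \<noteq> y" "x \<noteq> z" "y \<noteq> z" using edge_neq[OF E] T by auto
  have SV: "x \<in> verts G" "y \<in> verts G" "z \<in> verts G"
    using T assms(1) unfolding simple_graph_def by auto
  \<comment> \<open>At most two edges at \<open>t\<close> stay inside the triangle, so degree three
    forces one that leaves it.\<close>
  have deg: "outer ?E ?S t \<noteq> {}" if t: "t \<in> ?S" for t
  proof
    assume empty: "outer ?E ?S t = {}"
    have "{e \<in> ?E. t \<in> e} \<subseteq> (\<lambda>v. {t, v}) ` (?S - {t})"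
    proof
      fix e assume "e \<in> {e \<in> ?E. t \<in> e}"
      then have e: "e \<in> ?E" "t \<in> e" by simp_all
      obtain v where v: "e = {t, v}" "t \<noteq> v" using edge_at[OF E e] .
      then have "v \<in> ?S" using empty e(1) unfolding outer_def by blast
      then show "e \<in> (\<lambda>v. {t, v}) ` (?S - {t})" using v by blast
    qed
    then have "degree G t \<le> card (?S - {t})"
      unfolding degree_def by (rule surj_card_le[rotated]) simp
    also have "\<dots> = 2" using t ne by (auto simp: card_Diff_singleton)
    finally show False using assms(6-8) t by auto
  qed
  interpret triangle_wed ?E k ?S x y z
  proof
    show "edge_set ?E" "well_dominated ?E k" using E k .
    show "{a, b, c} = ?S" if "{a, b} \<in> ?E" "{b, c} \<in> ?E" "{a, c} \<in> ?E" for a b c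
    proof -
      have "Graph {a, b, c} {{a, b}, {a, c}, {b, c}} \<in> {T. triangle_of G T}"
        using triangle_ofI[OF assms(1) that] by simp
      then show ?thesis unfolding assms(4) by simp
    qed
    show "outer ?E ?S t \<noteq> {}" if "t \<in> ?S" for t using deg[OF that] .
  qed (use T in simp_all)
  \<comment> \<open>\<open>D\<close> is the deleted edge and \<open>t\<close> the third triangle
    vertex. A walk in \<open>H\<close> from \<open>n\<close> to a neighbor of \<open>t\<close>
    survives in \<open>G - D\<close> and would put \<open>n\<close> into the component of
    \<open>t\<close>.\<close>
  have miss: "\<exists>s\<in>?S. \<exists>n\<in>N s. \<forall>w. reach n w \<longrightarrow> w \<notin> N t"
    if D: "D \<in> {{x, y}, {x, z}, {y, z}}" and t: "?S = insert t D" "t \<notin> D" for t D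
  proof -
    obtain s0 where s0: "s0 \<in> D" using D by auto
    have s0V: "s0 \<in> verts G" using D s0 SV by auto
    have "2 \<le> card {C \<in> components (delete_verts G D). nontrivial C}" using bspec[OF assms(5) D] .
    from second_component[OF assms(1,2) this s0 s0V, of t] obtain n s
      where n: "(t, n) \<notin> (adj (del ?E D))\<^sup>*" "n \<notin> D" "s \<in> D" "{s, n} \<in> ?E" by blast
    have "n \<noteq> t" using n(1) by auto
    then have nN: "n \<in> N s" using n(2,4) unfolding t(1) outer_def by simp
    have "w \<notin> N t" if "reach n w" for w
    proof
      assume w: "w \<in> N t"
      have "H \<subseteq> del ?E D" unfolding t(1) del_def by auto
      then have "(n, w) \<in> (adj (del ?E D))\<^sup>*" using adj_mono that by metis
      moreover have "{t, w} \<in> del ?E D"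
        using N_edge[OF w] N_notin[OF w] t(2) unfolding t(1) del_def by auto
      then have "(t, w) \<in> (adj (del ?E D))\<^sup>*" by (simp add: adj_iff r_into_rtrancl)
      ultimately show False using n(1) reach_sym rtrancl_trans by metis
    qed
    moreover have "s \<in> ?S" using n(3) unfolding t(1) by simp
    ultimately show ?thesis using nN by blast
  qed
  have "\<exists>s\<in>?S. \<exists>n\<in>N s. \<forall>w. reach n w \<longrightarrow> w \<notin> N t" if "t \<in> ?S" for t
  proof -
    consider "t = x" | "t = y" | "t = z" using \<open>t \<in> ?S\<close> by blast
    then show ?thesis
    proof cases
      case 1
      show ?thesis by (rule miss[of "{y, z}"]) (use 1 ne in auto)
    next
      case 2
      show ?thesis by (rule miss[of "{x, z}"]) (use 2 ne in auto)
    next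
      case 3
      show ?thesis by (rule miss[of "{x, y}"]) (use 3 ne in auto)
    qed
  qed
  from exists_house_case[OF this] obtain x' y' z' where "house_case ?E k ?S x' y' z'" by blast
  from house_case.exists_house_end[OF this] obtain p q where "house_end ?E k ?S x' y' z' p q" by blast
  then show ?thesis by (rule house_end_family[OF assms(1,2)])
qed

end
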